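(* The Hilbert-style proof system $\mathsf{C}( *,-\!* )$ described in the context is sound and complete for quantifier-free separation logic $\mathrm{SL}( *,-\!* )$: for every formula $\varphi$ of $\mathrm{SL}( *,-\!* )$, $\varphi$ is valid if and only if $\vdash_{\mathsf{C}( *,-\!* )} \varphi$.
   Context: Let $\mathrm{PVAR}$ be a countably infinite set of program variables and $\mathrm{LOC}$ a countably infinite set of locations. A memory state is a pair $(s,h)$ with $s:\mathrm{PVAR}\to\mathrm{LOC}$ (store) and $h:\mathrm{LOC}\to\mathrm{LOC}$ a partial function with finite domain $\mathrm{dom}(h)$ (heap). Heaps $h_1,h_2$ are disjoint if $\mathrm{dom}(h_1)\cap\mathrm{dom}(h_2)=\emptyset$, and then $h_1+h_2$ is the union of their graphs. Formulae of $\mathrm{SL}( *,-\!* )$: $\varphi ::= x=y \mid x\hookrightarrow y \mid \mathrm{emp} \mid \neg\varphi \mid \varphi\wedge\varphi \mid \varphi*\varphi \mid \varphi -\!* \varphi$ with $x,y\in\mathrm{PVAR}$. Semantics: $(s,h)\models x=y$ iff $s(x)=s(y)$; $(s,h)\models x\hookrightarrow y$ iff $s(x)\in\mathrm{dom}(h)$ and $h(s(x))=s(y)$; $(s,h)\models\mathrm{emp}$ iff $\mathrm{dom}(h)=\emptyset$; Boolean connectives as usual; $(s,h)\models\varphi_1*\varphi_2$ iff there are disjoint $h_1,h_2$ with $h_1+h_2=h$, $(s,h_1)\models\varphi_1$, $(s,h_2)\models\varphi_2$; $(s,h)\models\varphi_1-\!*\varphi_2$ iff for every $h_1$ disjoint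 from $h$ with $(s,h_1)\models\varphi_1$, $(s,h+h_1)\models\varphi_2$. A formula is valid if satisfied by every memory state. Abbreviations: $\bot := \neg(x=x)$, $\top:=\neg\bot$, $\vee,\Rightarrow,\Leftrightarrow$ as usual; $x\neq y := \neg(x=y)$; $\varphi -\!\circledast \psi := \neg(\varphi -\!* \neg\psi)$; $\mathrm{alloc}(x) := (x\hookrightarrow x)-\!*\bot$ (holds iff $s(x)\in\mathrm{dom}(h)$); $\mathrm{size}\geq 0:=\top$, $\mathrm{size}\geq 1:=\neg\mathrm{emp}$, $\mathrm{size}\geq\beta+2 := \neg\mathrm{emp} * \mathrm{size}\geq \beta+1$ (holds iff $|\mathrm{dom}(h)|\geq\beta$); $\mathrm{size}=\beta := \mathrm{size}\geq\beta\wedge\neg\,\mathrm{size}\geq\beta+1$; $a\dot{-}b$ is $a-b$ if $a\geq b$ and $0$ otherwise. A Hilbert-style proof system is a set of axiom schemata and inference rules; $\vdash_{\mathsf{S}}\varphi$ means $\varphi$ is derivable (closure of all substitution instances of axioms under the rules). Below, $\varphi,\psi,\chi$ range over formulae, $x,y,z$ over program variables, $\beta,\beta_1,\beta_2$ over natural numbers, $X$ over finite subsets of $\mathrm{PVAR}$; $\varphi[y\leftarrow x]$ denotes $\varphi$ with every occurrence of $y$ replaced by $x$. The system $\mathsf{C}( *,-\!* )$ consists of: all instances of propositional tautologies and modus ponens; the axioms (A1) $x=x$; (A2) $\varphi\wedge x=y\Rightarrow\varphi[y\leftarrow x]$; (A3) $x\hookrightarrow y\Rightarrow\mathrm{alloc}(x)$;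 (A4) $x\hookrightarrow y\wedge x\hookrightarrow z\Rightarrow y=z$; (A7) $(\varphi*\psi)\Leftrightarrow(\psi*\varphi)$; (A8) $(\varphi*\psi)*\chi\Leftrightarrow\varphi*(\psi*\chi)$; (I9) $(\varphi\vee\psi)*\chi\Rightarrow(\varphi*\chi)\vee(\psi*\chi)$; (I10) $(\bot*\varphi)\Leftrightarrow\bot$; (A11) $\varphi\Leftrightarrow\varphi*\mathrm{emp}$; (I12) $\mathrm{alloc}(x)*\top\Rightarrow\mathrm{alloc}(x)$; (I13) $(\mathrm{alloc}(x)*\mathrm{alloc}(x))\Leftrightarrow\bot$; (A14) $\lambda*\top\Rightarrow\lambda$ whenever $\lambda$ is $\neg\mathrm{emp}$, $x=y$, $x\neq y$ or $x\hookrightarrow y$; (A15) $\neg\mathrm{alloc}(x)*\neg\mathrm{alloc}(x)\Rightarrow\neg\mathrm{alloc}(x)$; (A16) $(\mathrm{alloc}(x)\wedge\neg x\hookrightarrow y)*\top\Rightarrow\neg x\hookrightarrow y$; (A17) $\mathrm{alloc}(x)\Rightarrow(\mathrm{alloc}(x)\wedge\mathrm{size}=1)*\top$; (A18) $\neg\mathrm{emp}\Rightarrow(\mathrm{size}=1)*\top$; (A19) $\neg\mathrm{size}\geq\beta_1*\neg\mathrm{size}\geq\beta_2\Rightarrow\neg\mathrm{size}\geq\beta_1+\beta_2\dot{-}1$; (A20) $\mathrm{alloc}(x)\wedge\mathrm{alloc}(y)\wedge x\neq y\Rightarrow\mathrm{size}\geq 2$; (A21) $(\mathrm{size}=1\wedge\bigwedge_{x\in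 X}\neg\mathrm{alloc}(x))-\!\circledast\top$; (A22) $\neg\mathrm{alloc}(x)\Rightarrow((x\hookrightarrow y\wedge\mathrm{size}=1)-\!\circledast\top)$; (A23) $\neg\mathrm{alloc}(x)\Rightarrow((\mathrm{alloc}(x)\wedge\mathrm{size}=1\wedge\bigwedge_{y\in X}\neg x\hookrightarrow y)-\!\circledast\top)$; and the rules: ($*$-Intro) from $\varphi\Rightarrow\chi$ infer $\varphi*\psi\Rightarrow\chi*\psi$; ($*$-Adj) from $\varphi*\psi\Rightarrow\chi$ infer $\varphi\Rightarrow(\psi-\!*\chi)$; ($-\!*$-Adj) from $\varphi\Rightarrow(\psi-\!*\chi)$ infer $\varphi*\psi\Rightarrow\chi$. *)

theory Defs
  imports Main "HOL-Library.Countable" "HOL-Library.Infinite_Typeclass"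
begin

(* PVAR and LOC are the type parameters 'v and 'l; the theorem assumes both to be countably
   infinite through the sort {countable, infinite}. *)

datatype 'v fml =
    Eq 'v 'v  (infix "\<^bold>=" 65)
  | PointsTo 'v 'v  (infix "\<^bold>\<hookrightarrow>" 65)
  | Emp
  | Neg "'v fml"  ("\<^bold>\<not> _" [63] 63)
  | And "'v fml" "'v fml"  (infixr "\<^bold>\<and>" 60)
  | Star "'v fml" "'v fml"  (infixr "\<^bold>*" 62)
  | Wand "'v fml" "'v fml"  (infixr "\<^bold>-*" 61)


subsection \<open>Semantics\<close>

type_synonym ('v, 'l) store = "'v \<Rightarrow> 'l"
type_synonym 'l heap = "'l \<rightharpoonup> 'l"

definition disj_heaps :: "'l heap \<Rightarrow> 'l heap \<Rightarrow> bool"  (infix "\<sharp>" 50) where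
  "h1 \<sharp> h2 \<longleftrightarrow> dom h1 \<inter> dom h2 = {}"

(* Heaps are the maps with finite domain. The maps h1, h2 in the clause for the separating
   conjunction are submaps of h, so only the wand has to require finiteness.
   On disjoint heaps, ++ is the union of the graphs. *)
primrec sat :: "('v, 'l) store \<Rightarrow> 'l heap \<Rightarrow> 'v fml \<Rightarrow> bool"  ("'(_, _') \<Turnstile> _" [0, 0, 50] 50)
where
  "(s, h) \<Turnstile> x \<^bold>= y \<longleftrightarrow> s x = s y"
| "(s, h) \<Turnstile> x \<^bold>\<hookrightarrow> y \<longleftrightarrow> h (s x) = Some (s y)"
| "(s, h) \<Turnstile> Emp \<longleftrightarrow> dom h = {}"
| "(s, h) \<Turnstile> \<^bold>\<not> \<phi> \<longleftrightarrow> \<not> (s, h) \<Turnstile> \<phi>"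
| "(s, h) \<Turnstile> \<phi> \<^bold>\<and> \<psi> \<longleftrightarrow> (s, h) \<Turnstile> \<phi> \<and> (s, h) \<Turnstile> \<psi>"
| "(s, h) \<Turnstile> \<phi> \<^bold>* \<psi> \<longleftrightarrow>
     (\<exists>h1 h2. h1 \<sharp> h2 \<and> h1 ++ h2 = h \<and> (s, h1) \<Turnstile> \<phi> \<and> (s, h2) \<Turnstile> \<psi>)"
| "(s, h) \<Turnstile> \<phi> \<^bold>-* \<psi> \<longleftrightarrow>
     (\<forall>h1. finite (dom h1) \<longrightarrow> h1 \<sharp> h \<longrightarrow> (s, h1) \<Turnstile> \<phi> \<longrightarrow> (s, h ++ h1) \<Turnstile> \<psi>)"

(* The first argument only fixes the type of locations, which does not occur in formulae. *)
definition valid :: "'l itself \<Rightarrow> 'v fml \<Rightarrow> bool" where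
  "valid L \<phi> \<longleftrightarrow> (\<forall>(s :: ('v, 'l) store) (h :: 'l heap). finite (dom h) \<longrightarrow> (s, h) \<Turnstile> \<phi>)"


subsection \<open>Derived connectives\<close>

(* The variable x in the abbreviation of falsum by not (x = x) is arbitrary but fixed;
   undefined plays this role here. *)
definition Bot :: "'v fml"  ("\<^bold>\<bottom>") where
  "\<^bold>\<bottom> = \<^bold>\<not> (undefined \<^bold>= undefined)"

definition Top :: "'v fml"  ("\<^bold>\<top>") where
  "\<^bold>\<top> = \<^bold>\<not> \<^bold>\<bottom>"

definition Or :: "'v fml \<Rightarrow> 'v fml \<Rightarrow> 'v fml"  (infixr "\<^bold>\<or>" 59) where
  "\<phi> \<^bold>\<or> \<psi> = \<^bold>\<not> (\<^bold>\<not> \<phi> \<^bold>\<and> \<^bold>\<not> \<psi>)"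

definition Imp :: "'v fml \<Rightarrow> 'v fml \<Rightarrow> 'v fml"  (infixr "\<^bold>\<longrightarrow>" 57) where
  "\<phi> \<^bold>\<longrightarrow> \<psi> = \<^bold>\<not> \<phi> \<^bold>\<or> \<psi>"

definition Iff :: "'v fml \<Rightarrow> 'v fml \<Rightarrow> 'v fml"  (infix "\<^bold>\<longleftrightarrow>" 56) where
  "\<phi> \<^bold>\<longleftrightarrow> \<psi> = (\<phi> \<^bold>\<longrightarrow> \<psi>) \<^bold>\<and> (\<psi> \<^bold>\<longrightarrow> \<phi>)"

definition Neq :: "'v \<Rightarrow> 'v \<Rightarrow> 'v fml"  (infix "\<^bold>\<noteq>" 65) where
  "x \<^bold>\<noteq> y = \<^bold>\<not> (x \<^bold>= y)"

definition Septraction :: "'v fml \<Rightarrow> 'v fml \<Rightarrow> 'v fml"  (infixr "\<^bold>-\<circledast>" 61) where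
  "\<phi> \<^bold>-\<circledast> \<psi> = \<^bold>\<not> (\<phi> \<^bold>-* \<^bold>\<not> \<psi>)"

definition alloc :: "'v \<Rightarrow> 'v fml" where
  "alloc x = (x \<^bold>\<hookrightarrow> x) \<^bold>-* \<^bold>\<bottom>"

fun size_ge :: "nat \<Rightarrow> 'v fml" where
  "size_ge 0 = \<^bold>\<top>"
| "size_ge (Suc 0) = \<^bold>\<not> Emp"
| "size_ge (Suc (Suc \<beta>)) = \<^bold>\<not> Emp \<^bold>* size_ge (Suc \<beta>)"

definition size_eq :: "nat \<Rightarrow> 'v fml" where
  "size_eq \<beta> = size_ge \<beta> \<^bold>\<and> \<^bold>\<not> size_ge (\<beta> + 1)"

definition big_and :: "'v fml list \<Rightarrow> 'v fml"  ("\<^bold>\<And>") where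
  "\<^bold>\<And> \<phi>s = foldr And \<phi>s \<^bold>\<top>"

(* replace y x phi is the formula phi with every occurrence of y replaced by x *)
definition replace :: "'v \<Rightarrow> 'v \<Rightarrow> 'v fml \<Rightarrow> 'v fml" where
  "replace y x \<phi> = map_fml (\<lambda>z. if z = y then x else z) \<phi>"


subsection \<open>Propositional tautologies\<close>

datatype pform = PVar nat | PNeg pform | PAnd pform pform

primrec peval :: "(nat \<Rightarrow> bool) \<Rightarrow> pform \<Rightarrow> bool" where
  "peval v (PVar n) = v n"
| "peval v (PNeg p) = (\<not> peval v p)"
| "peval v (PAnd p q) = (peval v p \<and> peval v q)"

definition tautology :: "pform \<Rightarrow> bool" where
  "tautology p \<longleftrightarrow> (\<forall>v. peval v p)"

primrec pinst :: "(nat \<Rightarrow> 'v fml) \<Rightarrow> pform \<Rightarrow> 'v fml" where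
  "pinst \<sigma> (PVar n) = \<sigma> n"
| "pinst \<sigma> (PNeg p) = \<^bold>\<not> pinst \<sigma> p"
| "pinst \<sigma> (PAnd p q) = pinst \<sigma> p \<^bold>\<and> pinst \<sigma> q"


subsection \<open>The proof system\<close>

(* A finite set X of variables indexing a conjunction is given by a duplicate-free list
   enumerating it; every enumeration yields an instance of the axiom. *)
inductive derivable :: "'v fml \<Rightarrow> bool"  ("\<turnstile> _" [50] 50) where
  Taut: "tautology p \<Longrightarrow> \<turnstile> pinst \<sigma> p"
| MP: "\<turnstile> \<phi> \<Longrightarrow> \<turnstile> \<phi> \<^bold>\<longrightarrow> \<psi> \<Longrightarrow> \<turnstile> \<psi>"
| A1: "\<turnstile> x \<^bold>= x"
| A2: "\<turnstile> \<phi> \<^bold>\<and> x \<^bold>= y \<^bold>\<longrightarrow> replace y x \<phi>"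
| A3: "\<turnstile> x \<^bold>\<hookrightarrow> y \<^bold>\<longrightarrow> alloc x"
| A4: "\<turnstile> x \<^bold>\<hookrightarrow> y \<^bold>\<and> x \<^bold>\<hookrightarrow> z \<^bold>\<longrightarrow> y \<^bold>= z"
| A7: "\<turnstile> (\<phi> \<^bold>* \<psi>) \<^bold>\<longleftrightarrow> (\<psi> \<^bold>* \<phi>)"
| A8: "\<turnstile> ((\<phi> \<^bold>* \<psi>) \<^bold>* \<chi>) \<^bold>\<longleftrightarrow> (\<phi> \<^bold>* (\<psi> \<^bold>* \<chi>))"
| I9: "\<turnstile> (\<phi> \<^bold>\<or> \<psi>) \<^bold>* \<chi> \<^bold>\<longrightarrow> (\<phi> \<^bold>* \<chi>) \<^bold>\<or> (\<psi> \<^bold>* \<chi>)"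
| I10: "\<turnstile> (\<^bold>\<bottom> \<^bold>* \<phi>) \<^bold>\<longleftrightarrow> \<^bold>\<bottom>"
| A11: "\<turnstile> \<phi> \<^bold>\<longleftrightarrow> (\<phi> \<^bold>* Emp)"
| I12: "\<turnstile> alloc x \<^bold>* \<^bold>\<top> \<^bold>\<longrightarrow> alloc x"
| I13: "\<turnstile> (alloc x \<^bold>* alloc x) \<^bold>\<longleftrightarrow> \<^bold>\<bottom>"
| A14_nemp: "\<turnstile> (\<^bold>\<not> Emp) \<^bold>* \<^bold>\<top> \<^bold>\<longrightarrow> \<^bold>\<not> Emp"
| A14_eq: "\<turnstile> (x \<^bold>= y) \<^bold>* \<^bold>\<top> \<^bold>\<longrightarrow> x \<^bold>= y"
| A14_neq: "\<turnstile> (x \<^bold>\<noteq> y) \<^bold>* \<^bold>\<top> \<^bold>\<longrightarrow> x \<^bold>\<noteq> y"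
| A14_pto: "\<turnstile> (x \<^bold>\<hookrightarrow> y) \<^bold>* \<^bold>\<top> \<^bold>\<longrightarrow> x \<^bold>\<hookrightarrow> y"
| A15: "\<turnstile> (\<^bold>\<not> alloc x) \<^bold>* (\<^bold>\<not> alloc x) \<^bold>\<longrightarrow> \<^bold>\<not> alloc x"
| A16: "\<turnstile> (alloc x \<^bold>\<and> \<^bold>\<not> (x \<^bold>\<hookrightarrow> y)) \<^bold>* \<^bold>\<top> \<^bold>\<longrightarrow> \<^bold>\<not> (x \<^bold>\<hookrightarrow> y)"
| A17: "\<turnstile> alloc x \<^bold>\<longrightarrow> (alloc x \<^bold>\<and> size_eq 1) \<^bold>* \<^bold>\<top>"
| A18: "\<turnstile> \<^bold>\<not> Emp \<^bold>\<longrightarrow> size_eq 1 \<^bold>* \<^bold>\<top>"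
| A19: "\<turnstile> (\<^bold>\<not> size_ge \<beta>1) \<^bold>* (\<^bold>\<not> size_ge \<beta>2) \<^bold>\<longrightarrow> \<^bold>\<not> size_ge (\<beta>1 + \<beta>2 - 1)"
| A20: "\<turnstile> alloc x \<^bold>\<and> alloc y \<^bold>\<and> x \<^bold>\<noteq> y \<^bold>\<longrightarrow> size_ge 2"
| A21: "distinct X \<Longrightarrow> \<turnstile> (size_eq 1 \<^bold>\<and> \<^bold>\<And> (map (\<lambda>x. \<^bold>\<not> alloc x) X)) \<^bold>-\<circledast> \<^bold>\<top>"
| A22: "\<turnstile> \<^bold>\<not> alloc x \<^bold>\<longrightarrow> ((x \<^bold>\<hookrightarrow> y \<^bold>\<and> size_eq 1) \<^bold>-\<circledast> \<^bold>\<top>)"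
| A23: "distinct X \<Longrightarrow>
    \<turnstile> \<^bold>\<not> alloc x \<^bold>\<longrightarrow>
      ((alloc x \<^bold>\<and> size_eq 1 \<^bold>\<and> \<^bold>\<And> (map (\<lambda>y. \<^bold>\<not> (x \<^bold>\<hookrightarrow> y)) X)) \<^bold>-\<circledast> \<^bold>\<top>)"
| Star_Intro: "\<turnstile> \<phi> \<^bold>\<longrightarrow> \<chi> \<Longrightarrow> \<turnstile> \<phi> \<^bold>* \<psi> \<^bold>\<longrightarrow> \<chi> \<^bold>* \<psi>"
| Star_Adj: "\<turnstile> \<phi> \<^bold>* \<psi> \<^bold>\<longrightarrow> \<chi> \<Longrightarrow> \<turnstile> \<phi> \<^bold>\<longrightarrow> (\<psi> \<^bold>-* \<chi>)"
| Wand_Adj: "\<turnstile> \<phi> \<^bold>\<longrightarrow> (\<psi> \<^bold>-* \<chi>) \<Longrightarrow> \<turnstile> \<phi> \<^bold>* \<psi> \<^bold>\<longrightarrow> \<chi>"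

end

(* Completeness by a canonical model. A world is a Boolean valuation of formulae that makes all
   theorems true, and worlds carry a ternary relation playing the role of the disjoint union of
   heaps. By prime filter arguments a world satisfies the star and the wand of two formulae exactly
   when the usual clauses hold for this relation, and the axioms say how the core formulae
   x = y, alloc(x), x |-> y and size >= n behave along it.

   A world and a memory state are similar if they agree on the core formulae over a finite set of
   variables, with sizes compared only up to a bound. A back-and-forth argument shows that similar
   worlds and states satisfy the same formulae of bounded rank: heaps are added to a world cell by
   cell with A21-A23, and taken away with A17 and A18, while in the concrete model one can choose
   fresh locations freely. A formula that is not derivable fails in some world, hence in a similar
   memory state. *)
theory Submission
  imports Defs
begin

text \<open>No normal forms are computed inside the calculus: the axioms serve as closure properties
  of worlds. The obstacle is that a world need not come from a heap, since nothing prevents it from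
  satisfying \<open>size_ge n\<close> for every \<open>n\<close>. A single map from worlds to memory
  states preserving the truth of all formulae is therefore out of reach, and the comparison is made
  for one formula at a time. The size bound behaves differently under the two connectives. Adding
  heaps loses no precision about truncated sizes, so the wand keeps the bound of its context. A
  splitting has to be precise enough for both parts, so the star adds their bounds, with
  \<open>card X\<close> more because cells at locations of variables cannot be distributed at
  will.\<close>

instance fml :: (countable) countable
  by countable_datatype

section \<open>The canonical model\<close>

definition boolean :: "('v fml \<Rightarrow> bool) \<Rightarrow> bool" where
  "boolean w \<longleftrightarrow> (\<forall>\<phi>. w (\<^bold>\<not> \<phi>) \<longleftrightarrow> \<not> w \<phi>) \<and> (\<forall>\<phi> \<psi>. w (\<phi> \<^bold>\<and> \<psi>) \<longleftrightarrow> w \<phi> \<and> w \<psi>)"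

lemma boolean_simps:
  assumes "boolean w"
  shows "w (\<^bold>\<not> \<phi>) \<longleftrightarrow> \<not> w \<phi>" "w (\<phi> \<^bold>\<and> \<psi>) \<longleftrightarrow> w \<phi> \<and> w \<psi>" "w (\<phi> \<^bold>\<or> \<psi>) \<longleftrightarrow> w \<phi> \<or> w \<psi>"
    "w (\<phi> \<^bold>\<longrightarrow> \<psi>) \<longleftrightarrow> (w \<phi> \<longrightarrow> w \<psi>)" "w (\<phi> \<^bold>\<longleftrightarrow> \<psi>) \<longleftrightarrow> (w \<phi> \<longleftrightarrow> w \<psi>)"
  using assms by (auto simp: boolean_def Or_def Imp_def Iff_def)

text \<open>The atoms of the propositional reading include whole formulae headed by star or wand.
  Naming each atom by its own code makes \<open>from_nat\<close> the substitution that undoes the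
  abstraction.\<close>

primrec skeleton :: "'v::countable fml \<Rightarrow> pform" where
  "skeleton (x \<^bold>= y) = PVar (to_nat (x \<^bold>= y))"
| "skeleton (x \<^bold>\<hookrightarrow> y) = PVar (to_nat (x \<^bold>\<hookrightarrow> y))"
| "skeleton Emp = PVar (to_nat (Emp :: 'v fml))"
| "skeleton (\<^bold>\<not> \<phi>) = PNeg (skeleton \<phi>)"
| "skeleton (\<phi> \<^bold>\<and> \<psi>) = PAnd (skeleton \<phi>) (skeleton \<psi>)"
| "skeleton (\<phi> \<^bold>* \<psi>) = PVar (to_nat (\<phi> \<^bold>* \<psi>))"
| "skeleton (\<phi> \<^bold>-* \<psi>) = PVar (to_nat (\<phi> \<^bold>-* \<psi>))"

lemma pinst_skeleton: "pinst from_nat (skeleton \<phi>) = \<phi>"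
  by (induction \<phi>) auto

text \<open>A valuation of propositional variables, composed with \<open>skeleton\<close>, is a
  \<open>boolean\<close> valuation of formulae, so the skeleton is a tautology. In this form
  propositional facts follow by \<open>boolean_simps\<close>, without an explicit
  \<open>pform\<close>.\<close>

lemma derivable_taut:
  fixes \<phi> :: "'v::countable fml"
  assumes "\<And>w. boolean w \<Longrightarrow> w \<phi>"
  shows "\<turnstile> \<phi>"
proof -
  have "boolean (\<lambda>\<phi> :: 'v fml. peval v (skeleton \<phi>))" for v
    by (simp add: boolean_def)
  then have "tautology (skeleton \<phi>)"
    using assms unfolding tautology_def by blast
  then show ?thesis
    using Taut[of "skeleton \<phi>" "from_nat :: nat \<Rightarrow> 'v fml"] by (simp add: pinst_skeleton)
qed

lemma derivable_conseq:
  fixes \<phi> :: "'v::countable fml"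
  assumes "\<turnstile> \<phi>" and "\<And>w. boolean w \<Longrightarrow> w \<phi> \<Longrightarrow> w \<psi>"
  shows "\<turnstile> \<psi>"
proof (rule MP[OF assms(1)], rule derivable_taut)
  fix w :: "'v fml \<Rightarrow> bool" assume "boolean w"
  then show "w (\<phi> \<^bold>\<longrightarrow> \<psi>)"
    using assms(2)[of w] by (simp add: boolean_simps)
qed

lemma derivable_conseq2:
  fixes \<phi> :: "'v::countable fml"
  assumes "\<turnstile> \<phi>" "\<turnstile> \<psi>" and "\<And>w. boolean w \<Longrightarrow> w \<phi> \<Longrightarrow> w \<psi> \<Longrightarrow> w \<chi>"
  shows "\<turnstile> \<chi>"
proof (rule MP[OF assms(2)], rule derivable_conseq[OF assms(1)])
  fix w :: "'v fml \<Rightarrow> bool" assume "boolean w" "w \<phi>"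
  then show "w (\<psi> \<^bold>\<longrightarrow> \<chi>)"
    using assms(3)[of w] by (simp add: boolean_simps)
qed

lemma derivable_conseq3:
  fixes \<phi> :: "'v::countable fml"
  assumes "\<turnstile> \<phi>1" "\<turnstile> \<phi>2" "\<turnstile> \<phi>3"
    and "\<And>w. boolean w \<Longrightarrow> w \<phi>1 \<Longrightarrow> w \<phi>2 \<Longrightarrow> w \<phi>3 \<Longrightarrow> w \<phi>"
  shows "\<turnstile> \<phi>"
proof (rule MP[OF assms(3)], rule derivable_conseq2[OF assms(1,2)])
  fix w :: "'v fml \<Rightarrow> bool" assume "boolean w" "w \<phi>1" "w \<phi>2"
  then show "w (\<phi>3 \<^bold>\<longrightarrow> \<phi>)"
    using assms(4)[of w] by (simp add: boolean_simps)
qed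

lemma Imp_refl: "\<turnstile> \<phi> \<^bold>\<longrightarrow> (\<phi> :: 'v::countable fml)"
  by (rule derivable_taut) (simp add: boolean_simps)

lemma Imp_trans:
  fixes \<phi> :: "'v::countable fml"
  assumes "\<turnstile> \<phi> \<^bold>\<longrightarrow> \<psi>" "\<turnstile> \<psi> \<^bold>\<longrightarrow> \<chi>"
  shows "\<turnstile> \<phi> \<^bold>\<longrightarrow> \<chi>"
  by (rule derivable_conseq2[OF assms]) (simp add: boolean_simps)

lemma Imp_And:
  fixes \<phi> :: "'v::countable fml"
  assumes "\<turnstile> \<phi> \<^bold>\<longrightarrow> \<psi>" "\<turnstile> \<phi> \<^bold>\<longrightarrow> \<chi>"
  shows "\<turnstile> \<phi> \<^bold>\<longrightarrow> \<psi> \<^bold>\<and> \<chi>"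
  by (rule derivable_conseq2[OF assms]) (simp add: boolean_simps)

lemma Or_Imp:
  fixes \<phi> :: "'v::countable fml"
  assumes "\<turnstile> \<phi> \<^bold>\<longrightarrow> \<chi>" "\<turnstile> \<psi> \<^bold>\<longrightarrow> \<chi>"
  shows "\<turnstile> \<phi> \<^bold>\<or> \<psi> \<^bold>\<longrightarrow> \<chi>"
  by (rule derivable_conseq2[OF assms]) (simp add: boolean_simps)

section \<open>Worlds as prime filters\<close>

definition world :: "('v fml \<Rightarrow> bool) \<Rightarrow> bool" where
  "world w \<longleftrightarrow> boolean w \<and> (\<forall>\<phi>. \<turnstile> \<phi> \<longrightarrow> w \<phi>)"

lemma worldD: "world w \<Longrightarrow> \<turnstile> \<phi> \<Longrightarrow> w \<phi>"
  by (simp add: world_def)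

lemma world_boolean: "world w \<Longrightarrow> boolean w"
  by (simp add: world_def)

lemma world_impD: "world w \<Longrightarrow> \<turnstile> \<phi> \<^bold>\<longrightarrow> \<psi> \<Longrightarrow> w \<phi> \<Longrightarrow> w \<psi>"
  using boolean_simps(4) worldD world_boolean by blast

lemma world_bot [simp]: "world w \<Longrightarrow> \<not> w \<^bold>\<bottom>"
  by (simp add: Bot_def boolean_simps world_boolean worldD A1)

lemma world_top [simp]: "world w \<Longrightarrow> w \<^bold>\<top>"
  by (simp add: Top_def boolean_simps world_boolean)

lemmas world_simps [simp] = boolean_simps[OF world_boolean]

lemma world_neq [simp]: "world w \<Longrightarrow> w (x \<^bold>\<noteq> y) \<longleftrightarrow> \<not> w (x \<^bold>= y)"
  by (simp add: Neq_def)

lemma world_big_and [simp]: "world w \<Longrightarrow> w (\<^bold>\<And> \<phi>s) \<longleftrightarrow> (\<forall>\<phi>\<in>set \<phi>s. w \<phi>)"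
  unfolding big_and_def by (induction \<phi>s) auto

lemma bot_imp: "\<turnstile> \<^bold>\<bottom> \<^bold>\<longrightarrow> (\<phi> :: 'v::countable fml)"
  by (rule derivable_conseq[OF A1[of undefined]]) (simp add: boolean_simps Bot_def)

text \<open>Equal premises give upward closure, and \<open>\<chi>\<close> being the conjunction
  gives closure under conjunction. A filter may contain falsum; consistency is supplied by the set
  \<open>I\<close> in \<open>prime_extension\<close>.\<close>

definition fml_filter :: "'v fml set \<Rightarrow> bool" where
  "fml_filter F \<longleftrightarrow> F \<noteq> {} \<and> (\<forall>\<phi>\<in>F. \<forall>\<psi>\<in>F. \<forall>\<chi>. (\<turnstile> \<phi> \<^bold>\<and> \<psi> \<^bold>\<longrightarrow> \<chi>) \<longrightarrow> \<chi> \<in> F)"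

lemma filterD: "fml_filter F \<Longrightarrow> \<phi> \<in> F \<Longrightarrow> \<psi> \<in> F \<Longrightarrow> \<turnstile> \<phi> \<^bold>\<and> \<psi> \<^bold>\<longrightarrow> \<chi> \<Longrightarrow> \<chi> \<in> F"
  unfolding fml_filter_def by blast

lemma filter_upper:
  fixes \<phi> :: "'v::countable fml"
  assumes "fml_filter F" "\<phi> \<in> F" "\<turnstile> \<phi> \<^bold>\<longrightarrow> \<chi>"
  shows "\<chi> \<in> F"
  by (rule filterD[OF assms(1,2,2)], rule derivable_conseq[OF assms(3)]) (simp add: boolean_simps)

lemma filter_theorem:
  fixes \<phi> :: "'v::countable fml"
  assumes "fml_filter F" "\<turnstile> \<phi>"
  shows "\<phi> \<in> F"
proof -
  obtain \<psi> where "\<psi> \<in> F"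
    using assms(1) unfolding fml_filter_def by blast
  then show ?thesis
    by (rule filter_upper[OF assms(1)], intro derivable_conseq[OF assms(2)]) (simp add: boolean_simps)
qed

lemma filter_and:
  fixes \<phi> :: "'v::countable fml"
  shows "fml_filter F \<Longrightarrow> \<phi> \<in> F \<Longrightarrow> \<psi> \<in> F \<Longrightarrow> \<phi> \<^bold>\<and> \<psi> \<in> F"
  using filterD Imp_refl by blast

lemma filter_principal: "fml_filter {\<psi>. \<turnstile> \<phi> \<^bold>\<longrightarrow> (\<psi> :: 'v::countable fml)}"
  unfolding fml_filter_def using Imp_refl[of \<phi>] Imp_And Imp_trans by blast

lemma filter_world: "world w \<Longrightarrow> fml_filter (Collect w)"
  unfolding fml_filter_def using world_top world_impD[of w] by fastforce

text \<open>\<open>I\<close> is the complement of an ideal; this is the prime filter theorem.\<close>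

lemma prime_extension:
  fixes F :: "'v::countable fml set"
  assumes F: "fml_filter F" and FI: "F \<subseteq> I"
    and up: "\<And>\<phi> \<psi>. \<phi> \<in> I \<Longrightarrow> \<turnstile> \<phi> \<^bold>\<longrightarrow> \<psi> \<Longrightarrow> \<psi> \<in> I"
    and prime: "\<And>\<phi> \<psi>. \<phi> \<^bold>\<or> \<psi> \<in> I \<Longrightarrow> \<phi> \<in> I \<or> \<psi> \<in> I"
    and bot: "\<^bold>\<bottom> \<notin> I"
  shows "\<exists>w. world w \<and> (\<forall>\<phi>\<in>F. w \<phi>) \<and> (\<forall>\<phi>. w \<phi> \<longrightarrow> \<phi> \<in> I)"
proof -
  let ?A = "{G. fml_filter G \<and> F \<subseteq> G \<and> G \<subseteq> I}"
  have chain: "\<Union>\<C> \<in> ?A" if ne: "\<C> \<noteq> {}" and "subset.chain ?A \<C>" for \<C>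
  proof -
    have sub: "\<C> \<subseteq> ?A" and lin: "\<And>G H. G \<in> \<C> \<Longrightarrow> H \<in> \<C> \<Longrightarrow> G \<subseteq> H \<or> H \<subseteq> G"
      using that(2) unfolding subset_chain_def by blast+
    obtain G where G: "G \<in> \<C>" "fml_filter G" "F \<subseteq> G"
      using ne sub by blast
    have "fml_filter (\<Union>\<C>)"
      unfolding fml_filter_def
    proof (intro conjI ballI allI impI)
      show "\<Union>\<C> \<noteq> {}"
        using G unfolding fml_filter_def by blast
      fix \<phi> \<psi> \<chi> assume "\<phi> \<in> \<Union>\<C>" "\<psi> \<in> \<Union>\<C>" and *: "\<turnstile> \<phi> \<^bold>\<and> \<psi> \<^bold>\<longrightarrow> \<chi>"
      then obtain H K where "H \<in> \<C>" "K \<in> \<C>" "\<phi> \<in> H" "\<psi> \<in> K"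
        by blast
      then obtain K where K: "K \<in> \<C>" "\<phi> \<in> K" "\<psi> \<in> K"
        using lin[of H K] by blast
      moreover have "fml_filter K"
        using K(1) sub by blast
      ultimately show "\<chi> \<in> \<Union>\<C>"
        using filterD[OF \<open>fml_filter K\<close> _ _ *] by blast
    qed
    then show ?thesis
      using G sub by blast
  qed
  have "?A \<noteq> {}"
    using F FI by blast
  then obtain M where "M \<in> ?A" and "\<forall>G\<in>?A. M \<subseteq> G \<longrightarrow> G = M"
    using subset_Zorn_nonempty[of ?A] chain by blast
  then have M: "fml_filter M" "F \<subseteq> M" "M \<subseteq> I" and max: "\<And>G. fml_filter G \<Longrightarrow> M \<subseteq> G \<Longrightarrow> G \<subseteq> I \<Longrightarrow> G = M"
    by blast+
  \<comment> \<open>If every conjunction of \<open>\<phi>\<close> with a member of \<open>M\<close>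
    lay in \<open>I\<close>, the filter generated by these conjunctions would lie in
    \<open>I\<close> and contain \<open>\<phi>\<close>, against the maximality of
    \<open>M\<close>.\<close>
  have ext: "\<exists>\<mu>\<in>M. \<mu> \<^bold>\<and> \<phi> \<notin> I" if "\<phi> \<notin> M" for \<phi>
  proof (rule ccontr)
    assume contra: "\<not> (\<exists>\<mu>\<in>M. \<mu> \<^bold>\<and> \<phi> \<notin> I)"
    let ?G = "{\<psi>. \<exists>\<mu>\<in>M. \<turnstile> \<mu> \<^bold>\<and> \<phi> \<^bold>\<longrightarrow> \<psi>}"
    have "\<turnstile> \<mu> \<^bold>\<and> \<phi> \<^bold>\<longrightarrow> \<mu>" for \<mu>
      by (rule derivable_taut) (simp add: boolean_simps)
    then have MG: "M \<subseteq> ?G"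
      by blast
    have "fml_filter ?G"
      unfolding fml_filter_def
    proof (intro conjI ballI allI impI)
      show "?G \<noteq> {}"
        using MG M(1) unfolding fml_filter_def by blast
      fix \<alpha> \<beta> \<chi> assume "\<alpha> \<in> ?G" "\<beta> \<in> ?G" and *: "\<turnstile> \<alpha> \<^bold>\<and> \<beta> \<^bold>\<longrightarrow> \<chi>"
      then obtain \<mu> \<nu> where \<mu>\<nu>: "\<mu> \<in> M" "\<nu> \<in> M"
        "\<turnstile> \<mu> \<^bold>\<and> \<phi> \<^bold>\<longrightarrow> \<alpha>" "\<turnstile> \<nu> \<^bold>\<and> \<phi> \<^bold>\<longrightarrow> \<beta>"
        by blast
      have "\<turnstile> (\<mu> \<^bold>\<and> \<nu>) \<^bold>\<and> \<phi> \<^bold>\<longrightarrow> \<chi>"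
        by (rule derivable_conseq3[OF \<mu>\<nu>(3,4) *]) (simp add: boolean_simps)
      with \<mu>\<nu> show "\<chi> \<in> ?G"
        using filter_and[OF M(1)] by blast
    qed
    moreover have "?G \<subseteq> I"
      using contra up by blast
    ultimately have "?G = M"
      using max MG by blast
    moreover obtain \<mu> where "\<mu> \<in> M"
      using M(1) unfolding fml_filter_def by blast
    moreover have "\<turnstile> \<mu> \<^bold>\<and> \<phi> \<^bold>\<longrightarrow> \<phi>"
      by (rule derivable_taut) (simp add: boolean_simps)
    ultimately show False
      using that by blast
  qed
  have neg: "\<^bold>\<not> \<phi> \<in> M \<longleftrightarrow> \<phi> \<notin> M" for \<phi>
  proof
    assume "\<^bold>\<not> \<phi> \<in> M"
    moreover have "\<turnstile> \<^bold>\<not> \<phi> \<^bold>\<and> \<phi> \<^bold>\<longrightarrow> \<^bold>\<bottom>"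
      by (rule derivable_taut) (simp add: boolean_simps)
    ultimately show "\<phi> \<notin> M"
      using filterD[OF M(1)] M(3) bot by blast
  next
    assume "\<phi> \<notin> M"
    show "\<^bold>\<not> \<phi> \<in> M"
    proof (rule ccontr)
      assume "\<^bold>\<not> \<phi> \<notin> M"
      then obtain \<mu> \<nu> where *: "\<mu> \<in> M" "\<nu> \<in> M" "\<mu> \<^bold>\<and> \<phi> \<notin> I" "\<nu> \<^bold>\<and> \<^bold>\<not> \<phi> \<notin> I"
        using ext \<open>\<phi> \<notin> M\<close> by blast
      \<comment> \<open>Excluded middle for \<open>\<phi>\<close>: the disjunction belongs to
        \<open>M\<close> and so to \<open>I\<close>, but both disjuncts are outside the prime set
        \<open>I\<close>.\<close>
      have "\<turnstile> \<mu> \<^bold>\<and> \<nu> \<^bold>\<longrightarrow> (\<mu> \<^bold>\<and> \<phi>) \<^bold>\<or> (\<nu> \<^bold>\<and> \<^bold>\<not> \<phi>)"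
        by (rule derivable_taut) (simp add: boolean_simps)
      then show False
        using filterD[OF M(1)] M(3) prime * by blast
    qed
  qed
  have conj: "\<phi> \<^bold>\<and> \<psi> \<in> M \<longleftrightarrow> \<phi> \<in> M \<and> \<psi> \<in> M" for \<phi> \<psi>
  proof -
    have "\<turnstile> \<phi> \<^bold>\<and> \<psi> \<^bold>\<longrightarrow> \<phi>" "\<turnstile> \<phi> \<^bold>\<and> \<psi> \<^bold>\<longrightarrow> \<psi>"
      by (rule derivable_taut; simp add: boolean_simps)+
    then show ?thesis
      using filter_and filter_upper M(1) by blast
  qed
  have "world (\<lambda>\<phi>. \<phi> \<in> M)"
    unfolding world_def boolean_def using neg conj filter_theorem[OF M(1)] by blast
  then show ?thesis
    using M by (intro exI[of _ "\<lambda>\<phi>. \<phi> \<in> M"]) auto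
qed

text \<open>\<open>?I\<close> is the complement of the principal ideal below \<open>\<phi>\<close>;
  its primeness is \<open>Or_Imp\<close>.\<close>

lemma underivable_world:
  fixes \<phi> :: "'v::countable fml"
  assumes "\<not> \<turnstile> \<psi> \<^bold>\<longrightarrow> \<phi>"
  obtains w where "world w" "w \<psi>" "\<not> w \<phi>"
proof -
  let ?F = "{\<chi>. \<turnstile> \<psi> \<^bold>\<longrightarrow> \<chi>}" and ?I = "{\<chi>. \<not> \<turnstile> \<chi> \<^bold>\<longrightarrow> \<phi>}"
  have "\<exists>w. world w \<and> (\<forall>\<chi>\<in>?F. w \<chi>) \<and> (\<forall>\<chi>. w \<chi> \<longrightarrow> \<chi> \<in> ?I)"
  proof (rule prime_extension[of ?F ?I])
    show "fml_filter ?F"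
      by (rule filter_principal)
    show "?F \<subseteq> ?I"
      using assms Imp_trans by blast
    show "\<^bold>\<bottom> \<notin> ?I"
      using bot_imp by blast
  qed (use Imp_trans Or_Imp in blast)+
  then obtain w where "world w" "\<forall>\<chi>\<in>?F. w \<chi>" "\<forall>\<chi>. w \<chi> \<longrightarrow> \<chi> \<in> ?I"
    by blast
  then show thesis
    using that[of w] Imp_refl[of \<phi>] Imp_refl[of \<psi>] by blast
qed

text \<open>Completeness of the calculus with respect to worlds: from here on an implication can be
  derived by an argument inside an arbitrary world.\<close>

lemma derivable_imp_iff:
  fixes \<phi> :: "'v::countable fml"
  shows "(\<turnstile> \<phi> \<^bold>\<longrightarrow> \<psi>) \<longleftrightarrow> (\<forall>w. world w \<longrightarrow> w \<phi> \<longrightarrow> w \<psi>)"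
proof (intro iffI allI impI)
  assume *: "\<forall>w. world w \<longrightarrow> w \<phi> \<longrightarrow> w \<psi>"
  show "\<turnstile> \<phi> \<^bold>\<longrightarrow> \<psi>"
  proof (rule ccontr)
    assume "\<not> \<turnstile> \<phi> \<^bold>\<longrightarrow> \<psi>"
    then obtain w where "world w" "w \<phi>" "\<not> w \<psi>"
      by (rule underivable_world)
    with * show False
      by blast
  qed
qed (rule world_impD)

lemma derivable_iff:
  fixes \<phi> :: "'v::countable fml"
  shows "(\<turnstile> \<phi>) \<longleftrightarrow> (\<forall>w. world w \<longrightarrow> w \<phi>)"
proof (intro iffI allI impI)
  have "\<turnstile> (\<^bold>\<top> :: 'v fml)"
    by (rule derivable_conseq[OF A1[of undefined]]) (simp add: boolean_simps Top_def Bot_def)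
  moreover assume "\<forall>w. world w \<longrightarrow> w \<phi>"
  then have "\<turnstile> \<^bold>\<top> \<^bold>\<longrightarrow> \<phi>"
    unfolding derivable_imp_iff by blast
  ultimately show "\<turnstile> \<phi>"
    by (rule MP)
qed (rule worldD)

section \<open>Star and wand through composition of worlds\<close>

lemma world_star_commute: "world w \<Longrightarrow> w (\<phi> \<^bold>* \<psi>) \<longleftrightarrow> w (\<psi> \<^bold>* \<phi>)"
  using worldD[OF _ A7[of \<phi> \<psi>], of w] by simp

lemma world_star_mono:
  fixes \<phi> :: "'v::countable fml"
  assumes w: "world w" and "w (\<phi> \<^bold>* \<psi>)" "\<turnstile> \<phi> \<^bold>\<longrightarrow> \<phi>'" "\<turnstile> \<psi> \<^bold>\<longrightarrow> \<psi>'"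
  shows "w (\<phi>' \<^bold>* \<psi>')"
proof -
  have "w (\<phi>' \<^bold>* \<psi>)"
    using world_impD[OF w Star_Intro] assms by blast
  then have "w (\<psi> \<^bold>* \<phi>')"
    using world_star_commute[OF w] by blast
  then have "w (\<psi>' \<^bold>* \<phi>')"
    using world_impD[OF w Star_Intro] assms by blast
  then show ?thesis
    using world_star_commute[OF w] by blast
qed

lemma star_mono:
  fixes \<phi> :: "'v::countable fml"
  assumes "\<turnstile> \<phi> \<^bold>\<longrightarrow> \<phi>'" "\<turnstile> \<psi> \<^bold>\<longrightarrow> \<psi>'"
  shows "\<turnstile> \<phi> \<^bold>* \<psi> \<^bold>\<longrightarrow> \<phi>' \<^bold>* \<psi>'"
  unfolding derivable_imp_iff
proof (intro allI impI)
  fix w :: "'v fml \<Rightarrow> bool" assume "world w" "w (\<phi> \<^bold>* \<psi>)"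
  then show "w (\<phi>' \<^bold>* \<psi>')"
    by (rule world_star_mono[OF _ _ assms])
qed

lemma world_star_assoc: "world w \<Longrightarrow> w ((\<phi> \<^bold>* \<psi>) \<^bold>* \<chi>) \<longleftrightarrow> w (\<phi> \<^bold>* (\<psi> \<^bold>* \<chi>))"
  using worldD[OF _ A8[of \<phi> \<psi> \<chi>], of w] by simp

lemma world_star_or: "world w \<Longrightarrow> w ((\<phi> \<^bold>\<or> \<psi>) \<^bold>* \<chi>) \<Longrightarrow> w (\<phi> \<^bold>* \<chi>) \<or> w (\<psi> \<^bold>* \<chi>)"
  using worldD[OF _ I9[of \<phi> \<psi> \<chi>], of w] by simp

lemma world_star_bot: "world w \<Longrightarrow> \<not> w (\<^bold>\<bottom> \<^bold>* \<phi>)"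
  using worldD[OF _ I10[of \<phi>], of w] by simp

lemma world_star_emp: "world w \<Longrightarrow> w (\<phi> \<^bold>* Emp) \<longleftrightarrow> w \<phi>"
  using worldD[OF _ A11[of \<phi>], of w] by simp

text \<open>This is the filter that a composite of worlds extending \<open>F\<close> and
  \<open>G\<close> has to contain. Monotonicity of the star in both arguments gives closure under
  conjunction.\<close>

lemma filter_star:
  fixes F :: "'v::countable fml set"
  assumes F: "fml_filter F" and G: "fml_filter G"
  shows "fml_filter {\<chi>. \<exists>\<phi>\<in>F. \<exists>\<psi>\<in>G. \<turnstile> \<phi> \<^bold>* \<psi> \<^bold>\<longrightarrow> \<chi>}" (is "fml_filter ?G")
  unfolding fml_filter_def
proof (intro conjI ballI allI impI)
  show "?G \<noteq> {}"
    using assms Imp_refl unfolding fml_filter_def by blast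
  fix \<alpha> \<beta> \<chi> assume "\<alpha> \<in> ?G" "\<beta> \<in> ?G" and *: "\<turnstile> \<alpha> \<^bold>\<and> \<beta> \<^bold>\<longrightarrow> \<chi>"
  then obtain a b c d where abcd: "a \<in> F" "b \<in> G" "c \<in> F" "d \<in> G"
    "\<turnstile> a \<^bold>* b \<^bold>\<longrightarrow> \<alpha>" "\<turnstile> c \<^bold>* d \<^bold>\<longrightarrow> \<beta>"
    by blast
  have "\<turnstile> (a \<^bold>\<and> c) \<^bold>* (b \<^bold>\<and> d) \<^bold>\<longrightarrow> a \<^bold>* b" "\<turnstile> (a \<^bold>\<and> c) \<^bold>* (b \<^bold>\<and> d) \<^bold>\<longrightarrow> c \<^bold>* d"
    by (intro star_mono derivable_taut; simp add: boolean_simps)+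
  then have "\<turnstile> (a \<^bold>\<and> c) \<^bold>* (b \<^bold>\<and> d) \<^bold>\<longrightarrow> \<chi>"
    using abcd(5,6) * Imp_trans Imp_And by blast
  then show "\<chi> \<in> ?G"
    using abcd filter_and[OF F] filter_and[OF G] by blast
qed

text \<open>Negation makes inclusion symmetric. Hence completing the filter of a world can only
  return that world.\<close>

lemma world_maximal:
  assumes "world w" "world u" "\<And>\<phi>. w \<phi> \<Longrightarrow> u \<phi>"
  shows "u = w"
proof
  fix \<phi>
  show "u \<phi> = w \<phi>"
    using assms(3)[of \<phi>] assms(3)[of "\<^bold>\<not> \<phi>"] assms(1,2) by auto
qed

text \<open>The canonical counterpart of the heap of \<open>w\<close> being the disjoint union of those of
  \<open>w1\<close> and \<open>w2\<close>.\<close>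

definition composes :: "('v fml \<Rightarrow> bool) \<Rightarrow> ('v fml \<Rightarrow> bool) \<Rightarrow> ('v fml \<Rightarrow> bool) \<Rightarrow> bool" where
  "composes w1 w2 w \<longleftrightarrow> world w1 \<and> world w2 \<and> world w \<and> (\<forall>\<phi> \<psi>. w1 \<phi> \<longrightarrow> w2 \<psi> \<longrightarrow> w (\<phi> \<^bold>* \<psi>))"

lemma comp_world: "composes w1 w2 w \<Longrightarrow> world w1" "composes w1 w2 w \<Longrightarrow> world w2" "composes w1 w2 w \<Longrightarrow> world w"
  by (auto simp: composes_def)

lemma compD: "composes w1 w2 w \<Longrightarrow> w1 \<phi> \<Longrightarrow> w2 \<psi> \<Longrightarrow> w (\<phi> \<^bold>* \<psi>)"
  by (auto simp: composes_def)

lemma comp_commute: "composes w1 w2 w \<Longrightarrow> composes w2 w1 w"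
  unfolding composes_def using world_star_commute by blast

text \<open>The set \<open>?I\<close> of formulae that go together with all of \<open>G\<close>
  inside \<open>w\<close> is prime, as in the squeeze lemma of relevance logics: if
  \<open>\<phi>\<close> fails with \<open>a\<close> and \<open>\<psi>\<close> with \<open>b\<close>,
  then both fail with the conjunction of \<open>a\<close> and \<open>b\<close>, which contradicts
  I9.\<close>

lemma extend_star:
  fixes w :: "'v::countable fml \<Rightarrow> bool"
  assumes w: "world w" and F: "fml_filter F" and G: "fml_filter G"
    and FG: "\<And>\<phi> \<psi>. \<phi> \<in> F \<Longrightarrow> \<psi> \<in> G \<Longrightarrow> w (\<phi> \<^bold>* \<psi>)"
  shows "\<exists>u. world u \<and> (\<forall>\<phi>\<in>F. u \<phi>) \<and> (\<forall>\<phi> \<psi>. u \<phi> \<longrightarrow> \<psi> \<in> G \<longrightarrow> w (\<phi> \<^bold>* \<psi>))"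
proof -
  let ?I = "{\<phi>. \<forall>\<psi>\<in>G. w (\<phi> \<^bold>* \<psi>)}"
  have "\<exists>u. world u \<and> (\<forall>\<phi>\<in>F. u \<phi>) \<and> (\<forall>\<phi>. u \<phi> \<longrightarrow> \<phi> \<in> ?I)"
  proof (rule prime_extension[OF F, of ?I])
    show "F \<subseteq> ?I"
      using FG by blast
    show "\<^bold>\<bottom> \<notin> ?I"
      using world_star_bot[OF w] G unfolding fml_filter_def by blast
    show "\<psi> \<in> ?I" if "\<phi> \<in> ?I" "\<turnstile> \<phi> \<^bold>\<longrightarrow> \<psi>" for \<phi> \<psi>
      using that world_star_mono[OF w] Imp_refl by blast
    show "\<phi> \<in> ?I \<or> \<psi> \<in> ?I" if "\<phi> \<^bold>\<or> \<psi> \<in> ?I" for \<phi> \<psi>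
    proof (rule ccontr)
      assume "\<not> (\<phi> \<in> ?I \<or> \<psi> \<in> ?I)"
      then obtain a b where ab: "a \<in> G" "b \<in> G" "\<not> w (\<phi> \<^bold>* a)" "\<not> w (\<psi> \<^bold>* b)"
        by blast
      then have "w ((\<phi> \<^bold>\<or> \<psi>) \<^bold>* (a \<^bold>\<and> b))"
        using that filter_and[OF G] by blast
      moreover have "\<turnstile> a \<^bold>\<and> b \<^bold>\<longrightarrow> a" "\<turnstile> a \<^bold>\<and> b \<^bold>\<longrightarrow> b"
        by (rule derivable_taut; simp add: boolean_simps)+
      ultimately show False
        using ab world_star_or[OF w] world_star_mono[OF w _ Imp_refl] by blast
    qed
  qed
  then obtain u where "world u" "\<forall>\<phi>\<in>F. u \<phi>" "\<forall>\<phi>. u \<phi> \<longrightarrow> \<phi> \<in> ?I"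
    by blast
  then show ?thesis
    by (intro exI[of _ u]) blast
qed

text \<open>The factors are completed one after the other: \<open>F\<close> against the filter
  \<open>G\<close>, then \<open>G\<close> against the world obtained from \<open>F\<close>.\<close>

lemma comp_exists:
  fixes w :: "'v::countable fml \<Rightarrow> bool"
  assumes w: "world w" and F: "fml_filter F" and G: "fml_filter G"
    and FG: "\<And>\<phi> \<psi>. \<phi> \<in> F \<Longrightarrow> \<psi> \<in> G \<Longrightarrow> w (\<phi> \<^bold>* \<psi>)"
  shows "\<exists>w1 w2. composes w1 w2 w \<and> (\<forall>\<phi>\<in>F. w1 \<phi>) \<and> (\<forall>\<phi>\<in>G. w2 \<phi>)"
proof -
  obtain w1 where w1: "world w1" "\<forall>\<phi>\<in>F. w1 \<phi>" "\<forall>\<phi> \<psi>. w1 \<phi> \<longrightarrow> \<psi> \<in> G \<longrightarrow> w (\<phi> \<^bold>* \<psi>)"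
    using extend_star[OF w F G FG] by blast
  have "w (\<psi> \<^bold>* \<phi>)" if "\<psi> \<in> G" "\<phi> \<in> Collect w1" for \<phi> \<psi>
    using w1(3) that by (simp add: world_star_commute[OF w, of \<psi>])
  from extend_star[OF w G filter_world[OF w1(1)] this]
  obtain w2 where w2: "world w2" "\<forall>\<phi>\<in>G. w2 \<phi>"
      "\<forall>\<phi> \<psi>. w2 \<phi> \<longrightarrow> \<psi> \<in> Collect w1 \<longrightarrow> w (\<phi> \<^bold>* \<psi>)"
    by blast
  have "composes w1 w2 w"
    unfolding composes_def using w w1(1) w2(1,3) world_star_commute[OF w] by blast
  then show ?thesis
    using w1(2) w2(2) by (intro exI[of _ w1] exI[of _ w2]) blast
qed

lemma world_star_iff:
  fixes w :: "'v::countable fml \<Rightarrow> bool"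
  assumes w: "world w"
  shows "w (\<phi> \<^bold>* \<psi>) \<longleftrightarrow> (\<exists>w1 w2. composes w1 w2 w \<and> w1 \<phi> \<and> w2 \<psi>)"
proof
  assume "w (\<phi> \<^bold>* \<psi>)"
  then have "w (\<alpha> \<^bold>* \<beta>)" if "\<alpha> \<in> {\<alpha>. \<turnstile> \<phi> \<^bold>\<longrightarrow> \<alpha>}" "\<beta> \<in> {\<beta>. \<turnstile> \<psi> \<^bold>\<longrightarrow> \<beta>}" for \<alpha> \<beta>
    using that world_star_mono[OF w] by blast
  from comp_exists[OF w filter_principal filter_principal this]
  obtain w1 w2 where "composes w1 w2 w" "\<forall>\<alpha>\<in>{\<alpha>. \<turnstile> \<phi> \<^bold>\<longrightarrow> \<alpha>}. w1 \<alpha>" "\<forall>\<beta>\<in>{\<beta>. \<turnstile> \<psi> \<^bold>\<longrightarrow> \<beta>}. w2 \<beta>"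
    by blast
  then show "\<exists>w1 w2. composes w1 w2 w \<and> w1 \<phi> \<and> w2 \<psi>"
    using Imp_refl[of \<phi>] Imp_refl[of \<psi>] by (intro exI[of _ w1] exI[of _ w2]) blast
qed (auto dest: compD)

lemma comp_unit:
  fixes w :: "'v::countable fml \<Rightarrow> bool"
  assumes w: "world w"
  obtains e where "composes e w w" "e Emp"
proof -
  have "w (\<alpha> \<^bold>* \<beta>)" if "\<alpha> \<in> {\<alpha>. \<turnstile> Emp \<^bold>\<longrightarrow> \<alpha>}" "\<beta> \<in> Collect w" for \<alpha> \<beta>
    using that world_star_mono[OF w _ _ Imp_refl, of Emp \<beta> \<alpha>] w
    by (simp add: world_star_commute[of w Emp] world_star_emp)
  from comp_exists[OF w filter_principal filter_world[OF w] this]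
  obtain e w' where ew: "composes e w' w" "\<forall>\<alpha>\<in>{\<alpha>. \<turnstile> Emp \<^bold>\<longrightarrow> \<alpha>}. e \<alpha>" "\<forall>\<phi>\<in>Collect w. w' \<phi>"
    by blast
  have "w' = w"
    using ew(3) by (intro world_maximal[OF w comp_world(2)[OF ew(1)]]) simp
  moreover have "e Emp"
    using ew(2) Imp_refl[of Emp] by blast
  ultimately show thesis
    using that[of e] ew(1) by simp
qed

text \<open>The consequences of stars of members of \<open>w2\<close> and \<open>w3\<close> form a
  filter that is compatible with \<open>w1\<close> inside \<open>w\<close> by A8. Completing it
  gives \<open>v\<close>, while \<open>w1\<close> is maximal and comes back unchanged.\<close>

lemma comp_assoc:
  fixes w :: "'v::countable fml \<Rightarrow> bool"
  assumes "composes w1 w2 u" "composes u w3 w"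
  obtains v where "composes w2 w3 v" "composes w1 v w"
proof -
  note wd = comp_world[OF assms(1)] comp_world[OF assms(2)]
  let ?G = "{\<chi>. \<exists>\<phi>\<in>Collect w2. \<exists>\<psi>\<in>Collect w3. \<turnstile> \<phi> \<^bold>* \<psi> \<^bold>\<longrightarrow> \<chi>}"
  have G: "\<phi> \<^bold>* \<psi> \<in> ?G" if "w2 \<phi>" "w3 \<psi>" for \<phi> \<psi>
    using that Imp_refl by blast
  have G': "fml_filter ?G"
    using filter_star filter_world wd by blast
  have wG: "w (\<phi> \<^bold>* \<chi>)" if \<phi>\<chi>: "\<phi> \<in> Collect w1" "\<chi> \<in> ?G" for \<phi> \<chi>
  proof -
    obtain \<alpha> \<beta> where *: "w2 \<alpha>" "w3 \<beta>" "\<turnstile> \<alpha> \<^bold>* \<beta> \<^bold>\<longrightarrow> \<chi>"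
      using \<phi>\<chi>(2) by auto
    then have "w ((\<phi> \<^bold>* \<alpha>) \<^bold>* \<beta>)"
      using \<phi>\<chi>(1) compD[OF assms(1)] compD[OF assms(2)] by blast
    then show ?thesis
      using * world_star_mono[OF wd(6) _ Imp_refl] world_star_assoc[OF wd(6)] by blast
  qed
  obtain w1' v where v: "composes w1' v w" "\<forall>\<phi>\<in>Collect w1. w1' \<phi>" "\<forall>\<phi>\<in>?G. v \<phi>"
    using comp_exists[OF wd(6) filter_world[OF wd(1)] G' wG] by blast
  have "w1' = w1"
    using v(2) by (intro world_maximal[OF wd(1) comp_world(1)[OF v(1)]]) simp
  moreover have "composes w2 w3 v"
    unfolding composes_def using wd comp_world(2)[OF v(1)] G v(3) by blast
  ultimately show thesis
    using that v(1) by blast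
qed

lemma comp_assoc':
  fixes w :: "'v::countable fml \<Rightarrow> bool"
  assumes "composes w2 w3 v" "composes w1 v w"
  obtains u where "composes w1 w2 u" "composes u w3 w"
proof -
  obtain u where "composes w2 w1 u" "composes w3 u w"
    by (rule comp_assoc[OF comp_commute[OF assms(1)] comp_commute[OF assms(2)]])
  then show thesis
    using that comp_commute by blast
qed

text \<open>A failing wand is refuted in two separations. The first gives a world \<open>w1\<close>
  with \<open>\<phi>\<close> such that the wand from each of its members to \<open>\<psi>\<close>
  still fails in \<open>w\<close>; this condition is prime because a wand out of a disjunction
  follows from the wands out of the disjuncts. It makes the filter generated by stars of
  \<open>w\<close> and \<open>w1\<close> avoid everything that implies \<open>\<psi>\<close>, and
  the second separation completes this filter to \<open>w2\<close>.\<close>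

lemma world_wand_iff:
  fixes w :: "'v::countable fml \<Rightarrow> bool"
  assumes w: "world w"
  shows "w (\<phi> \<^bold>-* \<psi>) \<longleftrightarrow> (\<forall>w1 w2. composes w w1 w2 \<longrightarrow> w1 \<phi> \<longrightarrow> w2 \<psi>)"
proof (intro iffI allI impI)
  fix w1 w2 assume "w (\<phi> \<^bold>-* \<psi>)" "composes w w1 w2" "w1 \<phi>"
  then have "w2 ((\<phi> \<^bold>-* \<psi>) \<^bold>* \<phi>)" "world w2"
    by (auto simp: composes_def)
  then show "w2 \<psi>"
    using Wand_Adj[OF Imp_refl] world_impD by blast
next
  assume *: "\<forall>w1 w2. composes w w1 w2 \<longrightarrow> w1 \<phi> \<longrightarrow> w2 \<psi>"
  show "w (\<phi> \<^bold>-* \<psi>)"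
  proof (rule ccontr)
    assume neg: "\<not> w (\<phi> \<^bold>-* \<psi>)"
    let ?F = "{\<chi>. \<turnstile> \<phi> \<^bold>\<longrightarrow> \<chi>}" and ?I = "{\<chi>. \<not> w (\<chi> \<^bold>-* \<psi>)}"
    have anti: "\<turnstile> (\<alpha> \<^bold>-* \<psi>) \<^bold>\<longrightarrow> (\<beta> \<^bold>-* \<psi>)" if "\<turnstile> \<beta> \<^bold>\<longrightarrow> \<alpha>" for \<alpha> \<beta>
    proof -
      have "\<turnstile> (\<alpha> \<^bold>-* \<psi>) \<^bold>* \<beta> \<^bold>\<longrightarrow> (\<alpha> \<^bold>-* \<psi>) \<^bold>* \<alpha>"
        using that Imp_refl star_mono by blast
      then show ?thesis
        using Star_Adj Imp_trans Wand_Adj[OF Imp_refl[of "\<alpha> \<^bold>-* \<psi>"]] by blast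
    qed
    have "\<exists>w1. world w1 \<and> (\<forall>\<chi>\<in>?F. w1 \<chi>) \<and> (\<forall>\<chi>. w1 \<chi> \<longrightarrow> \<chi> \<in> ?I)"
    proof (rule prime_extension[OF filter_principal[of \<phi>], of ?I])
      show "?F \<subseteq> ?I"
        using neg world_impD[OF w] anti by blast
      show "\<beta> \<in> ?I" if "\<alpha> \<in> ?I" "\<turnstile> \<alpha> \<^bold>\<longrightarrow> \<beta>" for \<alpha> \<beta>
        using that world_impD[OF w] anti by blast
      have "\<turnstile> \<^bold>\<top> \<^bold>\<longrightarrow> (\<^bold>\<bottom> \<^bold>-* \<psi>)"
        by (rule Star_Adj, unfold derivable_imp_iff)
          (blast dest: world_star_bot world_star_commute[THEN iffD1])
      then show "\<^bold>\<bottom> \<notin> ?I"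
        using w world_impD[OF w] world_top[OF w] by blast
      show "\<alpha> \<in> ?I \<or> \<beta> \<in> ?I" if "\<alpha> \<^bold>\<or> \<beta> \<in> ?I" for \<alpha> \<beta>
      proof -
        let ?\<gamma> = "(\<alpha> \<^bold>-* \<psi>) \<^bold>\<and> (\<beta> \<^bold>-* \<psi>)"
        have "v \<psi>" if v: "world v" "v (?\<gamma> \<^bold>* (\<alpha> \<^bold>\<or> \<beta>))" for v
        proof -
          have "v (?\<gamma> \<^bold>* \<alpha>) \<or> v (?\<gamma> \<^bold>* \<beta>)"
            using v world_star_or world_star_commute by blast
          moreover have "\<turnstile> ?\<gamma> \<^bold>* \<alpha> \<^bold>\<longrightarrow> \<psi>" "\<turnstile> ?\<gamma> \<^bold>* \<beta> \<^bold>\<longrightarrow> \<psi>"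
            by (rule Wand_Adj, rule derivable_taut, simp add: boolean_simps)+
          ultimately show ?thesis
            using v(1) world_impD by blast
        qed
        then have "\<turnstile> ?\<gamma> \<^bold>\<longrightarrow> ((\<alpha> \<^bold>\<or> \<beta>) \<^bold>-* \<psi>)"
          using Star_Adj derivable_imp_iff by blast
        then show ?thesis
          using that w world_impD[OF w] by auto
      qed
    qed
    then obtain w1 where w1: "world w1" "\<forall>\<chi>\<in>?F. w1 \<chi>" "\<forall>\<chi>. w1 \<chi> \<longrightarrow> \<chi> \<in> ?I"
      by blast
    let ?G = "{\<chi>. \<exists>\<alpha>\<in>Collect w. \<exists>\<beta>\<in>Collect w1. \<turnstile> \<alpha> \<^bold>* \<beta> \<^bold>\<longrightarrow> \<chi>}" and ?J = "{\<chi>. \<not> \<turnstile> \<chi> \<^bold>\<longrightarrow> \<psi>}"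
    have G: "\<phi> \<^bold>* \<psi> \<in> ?G" if "w \<phi>" "w1 \<psi>" for \<phi> \<psi>
      using that Imp_refl by blast
    have "\<exists>w2. world w2 \<and> (\<forall>\<chi>\<in>?G. w2 \<chi>) \<and> (\<forall>\<chi>. w2 \<chi> \<longrightarrow> \<chi> \<in> ?J)"
    proof (rule prime_extension[of ?G ?J])
      show "?G \<subseteq> ?J"
      proof
        fix \<chi> assume "\<chi> \<in> ?G"
        then obtain \<alpha> \<beta> where ab: "w \<alpha>" "w1 \<beta>" "\<turnstile> \<alpha> \<^bold>* \<beta> \<^bold>\<longrightarrow> \<chi>"
          by auto
        have "\<not> \<turnstile> \<chi> \<^bold>\<longrightarrow> \<psi>"
        proof
          assume "\<turnstile> \<chi> \<^bold>\<longrightarrow> \<psi>"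
          with ab(3) have "\<turnstile> \<alpha> \<^bold>\<longrightarrow> (\<beta> \<^bold>-* \<psi>)"
            using Star_Adj Imp_trans by blast
          then show False
            using w1(3) ab world_impD[OF w] by blast
        qed
        then show "\<chi> \<in> ?J"
          by blast
      qed
      show "fml_filter ?G"
        using filter_star filter_world w w1(1) by blast
      show "\<^bold>\<bottom> \<notin> ?J"
        using bot_imp by blast
    qed (use Imp_trans Or_Imp in blast)+
    then obtain w2 where w2: "world w2" "\<forall>\<chi>\<in>?G. w2 \<chi>" "\<forall>\<chi>. w2 \<chi> \<longrightarrow> \<chi> \<in> ?J"
      by blast
    have "composes w w1 w2"
      unfolding composes_def using w w1(1) w2(1,2) G by blast
    moreover have "w1 \<phi>"
      using w1(2) Imp_refl by blast
    moreover have "\<not> w2 \<psi>"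
      using w2(3) Imp_refl by blast
    ultimately show False
      using * by blast
  qed
qed

section \<open>Core formulas along the composition of worlds\<close>

text \<open>A2 is only an implication; its instance for the negation of \<open>\<phi>\<close>
  supplies the converse.\<close>

lemma world_replace:
  assumes "world w" "w (x \<^bold>= y)"
  shows "w (replace y x \<phi>) \<longleftrightarrow> w \<phi>"
  using assms worldD[OF assms(1) A2[of \<phi> x y]] worldD[OF assms(1) A2[of "\<^bold>\<not> \<phi>" x y]]
  by (auto simp: replace_def)

lemma world_eq_subst:
  assumes "world w" "w (x \<^bold>= y)"
  shows "w (x \<^bold>= z) \<longleftrightarrow> w (y \<^bold>= z)" "w (z \<^bold>= x) \<longleftrightarrow> w (z \<^bold>= y)"
    "w (x \<^bold>\<hookrightarrow> z) \<longleftrightarrow> w (y \<^bold>\<hookrightarrow> z)" "w (z \<^bold>\<hookrightarrow> x) \<longleftrightarrow> w (z \<^bold>\<hookrightarrow> y)"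
    "w (alloc x) \<longleftrightarrow> w (alloc y)"
proof -
  show "w (x \<^bold>= z) \<longleftrightarrow> w (y \<^bold>= z)"
    using world_replace[OF assms, of "x \<^bold>= z"] world_replace[OF assms, of "y \<^bold>= z"]
    by (simp add: replace_def)
  show "w (z \<^bold>= x) \<longleftrightarrow> w (z \<^bold>= y)"
    using world_replace[OF assms, of "z \<^bold>= x"] world_replace[OF assms, of "z \<^bold>= y"]
    by (simp add: replace_def)
  show "w (x \<^bold>\<hookrightarrow> z) \<longleftrightarrow> w (y \<^bold>\<hookrightarrow> z)"
    using world_replace[OF assms, of "x \<^bold>\<hookrightarrow> z"] world_replace[OF assms, of "y \<^bold>\<hookrightarrow> z"]
    by (simp add: replace_def)
  show "w (z \<^bold>\<hookrightarrow> x) \<longleftrightarrow> w (z \<^bold>\<hookrightarrow> y)"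
    using world_replace[OF assms, of "z \<^bold>\<hookrightarrow> x"] world_replace[OF assms, of "z \<^bold>\<hookrightarrow> y"]
    by (simp add: replace_def)
  show "w (alloc x) \<longleftrightarrow> w (alloc y)"
    using world_replace[OF assms, of "alloc x"] world_replace[OF assms, of "alloc y"]
    by (simp add: replace_def alloc_def)
qed

lemma world_eq_refl: "world w \<Longrightarrow> w (x \<^bold>= x)"
  by (rule worldD[OF _ A1])

lemma world_pto_alloc: "world w \<Longrightarrow> w (x \<^bold>\<hookrightarrow> y) \<Longrightarrow> w (alloc x)"
  using worldD[OF _ A3[of x y], of w] by simp

lemma world_pto_iff: "world w \<Longrightarrow> w (x \<^bold>\<hookrightarrow> y) \<Longrightarrow> w (x \<^bold>\<hookrightarrow> z) \<longleftrightarrow> w (y \<^bold>= z)"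
  using worldD[OF _ A4[of x y z], of w] world_eq_subst(4)[of w y z x] by auto

lemma comp_invariant:
  assumes "composes w1 w2 w" "\<turnstile> \<phi> \<^bold>* \<^bold>\<top> \<^bold>\<longrightarrow> \<phi>" "w1 \<phi>"
  shows "w \<phi>"
  using compD[OF assms(1,3), of "\<^bold>\<top>"] world_impD[OF comp_world(3)[OF assms(1)] assms(2)]
    world_top[OF comp_world(2)[OF assms(1)]] by blast

text \<open>Both an equality and its negation pass from a part to the whole by A14, so the truth
  values coincide.\<close>

lemma comp_eq:
  assumes "composes w1 w2 w"
  shows "w1 (x \<^bold>= y) \<longleftrightarrow> w (x \<^bold>= y)" "w2 (x \<^bold>= y) \<longleftrightarrow> w (x \<^bold>= y)"
proof -
  have *: "w1 (x \<^bold>= y) \<longleftrightarrow> w (x \<^bold>= y)" if "composes w1 w2 w" for w1 w2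
    using comp_invariant[OF that A14_eq[of x y]] comp_invariant[OF that A14_neq[of x y]]
      comp_world[OF that] by auto
  show "w1 (x \<^bold>= y) \<longleftrightarrow> w (x \<^bold>= y)" "w2 (x \<^bold>= y) \<longleftrightarrow> w (x \<^bold>= y)"
    by (fact *[OF assms] *[OF comp_commute[OF assms]])+
qed

lemma comp_alloc_disjoint:
  assumes "composes w1 w2 w" "w1 (alloc x)"
  shows "\<not> w2 (alloc x)"
  using compD[OF assms, of "alloc x"] worldD[OF comp_world(3)[OF assms(1)] I13[of x]]
    comp_world(3)[OF assms(1)] by auto

lemma comp_alloc:
  assumes "composes w1 w2 w"
  shows "w (alloc x) \<longleftrightarrow> w1 (alloc x) \<or> w2 (alloc x)"
proof
  show "w (alloc x)" if "w1 (alloc x) \<or> w2 (alloc x)"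
    using that comp_invariant[OF assms I12] comp_invariant[OF comp_commute[OF assms] I12] by blast
  show "w1 (alloc x) \<or> w2 (alloc x)" if "w (alloc x)"
    using that compD[OF assms, of "\<^bold>\<not> alloc x" "\<^bold>\<not> alloc x"] comp_world[OF assms]
      worldD[OF comp_world(3)[OF assms] A15[of x]] by auto
qed

text \<open>What points in the whole is allocated in the whole, hence in one part by A15; if that
  part lacked the pointer, A16 would deny it to the whole.\<close>

lemma comp_pto:
  assumes "composes w1 w2 w"
  shows "w (x \<^bold>\<hookrightarrow> y) \<longleftrightarrow> w1 (x \<^bold>\<hookrightarrow> y) \<or> w2 (x \<^bold>\<hookrightarrow> y)"
proof
  show "w (x \<^bold>\<hookrightarrow> y)" if "w1 (x \<^bold>\<hookrightarrow> y) \<or> w2 (x \<^bold>\<hookrightarrow> y)"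
    using that comp_invariant[OF assms A14_pto] comp_invariant[OF comp_commute[OF assms] A14_pto]
    by blast
  have *: "w1 (x \<^bold>\<hookrightarrow> y)" if "w (x \<^bold>\<hookrightarrow> y)" "w1 (alloc x)" "composes w1 w2 w" for w1 w2
    using that(1,2) compD[OF that(3), of "alloc x \<^bold>\<and> \<^bold>\<not> (x \<^bold>\<hookrightarrow> y)" "\<^bold>\<top>"] comp_world[OF that(3)]
      worldD[OF comp_world(3)[OF that(3)] A16[of x y]] by auto
  show "w1 (x \<^bold>\<hookrightarrow> y) \<or> w2 (x \<^bold>\<hookrightarrow> y)" if "w (x \<^bold>\<hookrightarrow> y)"
    using *[OF that _ assms] *[OF that _ comp_commute[OF assms]] comp_alloc[OF assms]
      world_pto_alloc[OF comp_world(3)[OF assms] that] by blast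
qed

section \<open>Counting cells\<close>

lemma size_ge_Suc:
  fixes w :: "'v::countable fml \<Rightarrow> bool"
  assumes "world w"
  shows "w (size_ge (Suc n)) \<longleftrightarrow> (\<exists>w1 w2. composes w1 w2 w \<and> \<not> w1 Emp \<and> w2 (size_ge n))"
proof (cases n)
  \<comment> \<open>\<open>size_ge 1\<close> is the negation of \<open>Emp\<close> itself and not a
    star as in the later clauses; A14 and an empty companion of \<open>w\<close> bridge the
    difference.\<close>
  case 0
  obtain e where e: "composes e w w"
    by (rule comp_unit[OF assms])
  have "\<not> w Emp" if "composes w1 w2 w" "\<not> w1 Emp" for w1 w2
    using comp_invariant[OF that(1) A14_nemp] comp_world[OF that(1)] that(2) by simp
  moreover have "e \<^bold>\<top>"
    using comp_world(1)[OF e] by simp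
  ultimately show ?thesis
    using 0 assms comp_commute[OF e] by auto
next
  case (Suc m)
  have "composes w1 w2 w \<and> w1 (\<^bold>\<not> Emp) \<and> w2 (size_ge n) \<longleftrightarrow> composes w1 w2 w \<and> \<not> w1 Emp \<and> w2 (size_ge n)"
    for w1 w2
    using comp_world(1)[of w1 w2 w] by auto
  then show ?thesis
    using Suc world_star_iff[OF assms, of "\<^bold>\<not> Emp" "size_ge n"] by simp
qed

text \<open>Reassociation moves a nonempty factor of \<open>w1\<close> to the outside, which lowers
  \<open>n\<close> by one.\<close>

lemma comp_size_mono:
  fixes w :: "'v::countable fml \<Rightarrow> bool"
  assumes "composes w1 w2 w" "w1 (size_ge n)"
  shows "w (size_ge n)"
  using assms
proof (induction n arbitrary: w1 w2 w)
  case 0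
  then show ?case
    using comp_world(3)[OF "0.prems"(1)] by simp
next
  case (Suc n)
  obtain a b where ab: "composes a b w1" "\<not> a Emp" "b (size_ge n)"
    using Suc.prems(2) size_ge_Suc[OF comp_world(1)[OF Suc.prems(1)], of n] by blast
  obtain v where v: "composes b w2 v" "composes a v w"
    by (rule comp_assoc[OF ab(1) Suc.prems(1)])
  then show ?case
    using Suc.IH[OF v(1) ab(3)] ab size_ge_Suc[OF comp_world(3)[OF v(2)], of n] by blast
qed

lemma comp_size_add:
  fixes w :: "'v::countable fml \<Rightarrow> bool"
  assumes "composes w1 w2 w" "w1 (size_ge n)" "w2 (size_ge m)"
  shows "w (size_ge (n + m))"
  using assms
proof (induction n arbitrary: w1 w2 w)
  case 0
  then show ?case
    using comp_size_mono[OF comp_commute[OF "0.prems"(1)]] by simp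
next
  case (Suc n)
  obtain a b where ab: "composes a b w1" "\<not> a Emp" "b (size_ge n)"
    using Suc.prems(2) size_ge_Suc[OF comp_world(1)[OF Suc.prems(1)], of n] by blast
  obtain v where v: "composes b w2 v" "composes a v w"
    by (rule comp_assoc[OF ab(1) Suc.prems(1)])
  then show ?case
    using Suc.IH[OF v(1) ab(3) Suc.prems(3)] ab size_ge_Suc[OF comp_world(3)[OF v(2)], of "n + m"]
    by auto
qed

lemma size_ge_antimono:
  fixes w :: "'v::countable fml \<Rightarrow> bool"
  assumes "world w" "w (size_ge n)" "m \<le> n"
  shows "w (size_ge m)"
proof -
  have step: "w (size_ge k)" if k: "w (size_ge (Suc k))" for k
  proof -
    obtain a b where ab: "composes a b w" "b (size_ge k)"
      using k size_ge_Suc[OF assms(1), of k] by blast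
    show ?thesis
      by (rule comp_size_mono[OF comp_commute[OF ab(1)] ab(2)])
  qed
  show ?thesis
    using assms(3,2) by (induction rule: inc_induct) (auto intro: step)
qed

text \<open>Parts with at most \<open>n\<close> and \<open>m\<close> cells make at most
  \<open>n + m\<close>: in A19 the subtraction turns \<open>Suc n + Suc m - 1\<close> into
  \<open>Suc (n + m)\<close>.\<close>

lemma comp_size_less:
  assumes "composes w1 w2 w" "\<not> w1 (size_ge (Suc n))" "\<not> w2 (size_ge (Suc m))"
  shows "\<not> w (size_ge (Suc (n + m)))"
  using compD[OF assms(1), of "\<^bold>\<not> size_ge (Suc n)" "\<^bold>\<not> size_ge (Suc m)"] assms(2,3) comp_world[OF assms(1)]
    worldD[OF comp_world(3)[OF assms(1)] A19[of "Suc n" "Suc m"]] by auto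

lemma size_eq_iff: "world w \<Longrightarrow> w (size_eq n) \<longleftrightarrow> w (size_ge n) \<and> \<not> w (size_ge (Suc n))"
  by (simp add: size_eq_def)

lemma size_eqD:
  fixes w :: "'v::countable fml \<Rightarrow> bool"
  assumes "world w" "w (size_eq n)"
  shows "w (size_ge m) \<longleftrightarrow> m \<le> n"
  using assms size_ge_antimono[OF assms(1), of n m] size_ge_antimono[OF assms(1), of m "Suc n"]
  by (cases "m \<le> n") (auto simp: size_eq_iff)

text \<open>A part of exactly known size can be subtracted: lower bounds add up, and A19 is the
  matching upper bound. This stands in for cancellation in all later counting.\<close>

lemma comp_size_eq:
  fixes w :: "'v::countable fml \<Rightarrow> bool"
  assumes "composes c u w" "c (size_eq n)"
  shows "w (size_ge (n + m)) \<longleftrightarrow> u (size_ge m)"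
proof -
  have c: "c (size_ge n)" "\<not> c (size_ge (Suc n))"
    using assms(2) size_eq_iff[OF comp_world(1)[OF assms(1)]] by blast+
  show ?thesis
  proof (cases m)
    case 0
    then show ?thesis
      using comp_size_mono[OF assms(1) c(1)] comp_world(2)[OF assms(1)] by simp
  next
    case (Suc k)
    then show ?thesis
      using comp_size_add[OF assms(1) c(1), of m] comp_size_less[OF assms(1) c(2), of k] by auto
  qed
qed

lemma comp_size_eq_add:
  fixes w :: "'v::countable fml \<Rightarrow> bool"
  assumes "composes c u w" "c (size_eq n)" "u (size_eq m)"
  shows "w (size_eq (n + m))"
  using assms(3) comp_size_eq[OF assms(1,2), of m] comp_size_eq[OF assms(1,2), of "Suc m"] comp_world[OF assms(1)]
  by (simp add: size_eq_iff)

lemma emp_size: "world w \<Longrightarrow> w (size_eq 0) \<longleftrightarrow> w Emp"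
  by (simp add: size_eq_iff)

section \<open>Removing and adding a single cell\<close>

lemma alloc_pick:
  fixes w :: "'v::countable fml \<Rightarrow> bool"
  assumes "world w" "w (alloc x)"
  obtains c u where "composes c u w" "c (alloc x)" "c (size_eq 1)"
proof -
  have "w ((alloc x \<^bold>\<and> size_eq 1) \<^bold>* \<^bold>\<top>)"
    using world_impD[OF assms(1) A17 assms(2)] .
  then obtain c u where "composes c u w" "c (alloc x \<^bold>\<and> size_eq 1)"
    using world_star_iff[OF assms(1)] by blast
  then show thesis
    using that comp_world(1)[of c u w] by simp
qed

lemma size_pick:
  fixes w :: "'v::countable fml \<Rightarrow> bool"
  assumes "world w" "\<not> w Emp"
  obtains c u where "composes c u w" "c (size_eq 1)"
proof -
  have "w (size_eq 1 \<^bold>* \<^bold>\<top>)"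
    using worldD[OF assms(1) A18] assms by simp
  then show thesis
    using that world_star_iff[OF assms(1)] by blast
qed

text \<open>A17 would split off a part of size one, giving the world positive size.\<close>

lemma emp_not_alloc:
  fixes w :: "'v::countable fml \<Rightarrow> bool"
  assumes "world w" "w Emp"
  shows "\<not> w (alloc x)"
proof
  assume "w (alloc x)"
  then obtain c u where cu: "composes c u w" "c (size_eq 1)"
    by (rule alloc_pick[OF assms(1)])
  then have "w (size_ge (1 + 0))"
    using comp_size_eq[OF cu, of 0] comp_world(2)[OF cu(1)] by simp
  then show False
    using assms by simp
qed

text \<open>An allocated variable different from \<open>x\<close> would force size two by
  A20.\<close>

lemma single_alloc:
  fixes w :: "'v::countable fml \<Rightarrow> bool"
  assumes "world w" "w (size_eq 1)" "w (alloc x)"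
  shows "w (alloc y) \<longleftrightarrow> w (x \<^bold>= y)"
proof
  show "w (x \<^bold>= y)" if "w (alloc y)"
    using that assms worldD[OF assms(1) A20[of x y]] size_eqD[OF assms(1,2), of 2] by auto
qed (use world_eq_subst(5)[OF assms(1)] assms(3) in blast)

text \<open>A21 to A23 promise extensions in the form of septractions; the clause for the wand turns
  them into composites of worlds.\<close>

lemma world_septraction:
  fixes w :: "'v::countable fml \<Rightarrow> bool"
  assumes "world w" "w (\<phi> \<^bold>-\<circledast> \<psi>)"
  obtains w1 w2 where "composes w w1 w2" "w1 \<phi>"
  using assms world_wand_iff[OF assms(1), of \<phi> "\<^bold>\<not> \<psi>"] unfolding Septraction_def by auto

lemma extend_fresh:
  fixes w :: "'v::countable fml \<Rightarrow> bool"
  assumes "world w" "finite X"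
  obtains c u where "composes w c u" "c (size_eq 1)" "\<forall>x\<in>X. \<not> c (alloc x)"
proof -
  obtain xs where xs: "set xs = X" "distinct xs"
    using finite_distinct_list[OF assms(2)] by blast
  obtain c u where "composes w c u" "c (size_eq 1 \<^bold>\<and> \<^bold>\<And> (map (\<lambda>x. \<^bold>\<not> alloc x) xs))"
    by (rule world_septraction[OF assms(1) worldD[OF assms(1) A21[OF xs(2)]]])
  then show thesis
    using that[of c u] comp_world(2)[of w c u] xs(1) by auto
qed

lemma extend_pto:
  fixes w :: "'v::countable fml \<Rightarrow> bool"
  assumes "world w" "\<not> w (alloc x)"
  obtains c u where "composes w c u" "c (size_eq 1)" "c (x \<^bold>\<hookrightarrow> y)"
proof -
  have "w ((x \<^bold>\<hookrightarrow> y \<^bold>\<and> size_eq 1) \<^bold>-\<circledast> \<^bold>\<top>)"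
    using worldD[OF assms(1) A22] assms by simp
  then obtain c u where "composes w c u" "c (x \<^bold>\<hookrightarrow> y \<^bold>\<and> size_eq 1)"
    by (rule world_septraction[OF assms(1)])
  then show thesis
    using that[of c u] comp_world(2)[of w c u] by auto
qed

lemma extend_dangling:
  fixes w :: "'v::countable fml \<Rightarrow> bool"
  assumes "world w" "\<not> w (alloc x)" "finite X"
  obtains c u where "composes w c u" "c (size_eq 1)" "c (alloc x)" "\<forall>y\<in>X. \<not> c (x \<^bold>\<hookrightarrow> y)"
proof -
  obtain xs where xs: "set xs = X" "distinct xs"
    using finite_distinct_list[OF assms(3)] by blast
  have "w ((alloc x \<^bold>\<and> size_eq 1 \<^bold>\<and> \<^bold>\<And> (map (\<lambda>y. \<^bold>\<not> (x \<^bold>\<hookrightarrow> y)) xs)) \<^bold>-\<circledast> \<^bold>\<top>)"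
    using worldD[OF assms(1) A23[OF xs(2)]] assms by simp
  then obtain c u where "composes w c u"
      "c (alloc x \<^bold>\<and> size_eq 1 \<^bold>\<and> \<^bold>\<And> (map (\<lambda>y. \<^bold>\<not> (x \<^bold>\<hookrightarrow> y)) xs))"
    by (rule world_septraction[OF assms(1)])
  then show thesis
    using that[of c u] comp_world(2)[of w c u] xs(1) by auto
qed

section \<open>Back-and-forth between worlds and memory states\<close>

definition agrees :: "'v set \<Rightarrow> ('v fml \<Rightarrow> bool) \<Rightarrow> ('v, 'l) store \<Rightarrow> 'l heap \<Rightarrow> bool" where
  "agrees X w s h \<longleftrightarrow> world w \<and> finite (dom h) \<and>
     (\<forall>x\<in>X. \<forall>y\<in>X. w (x \<^bold>= y) \<longleftrightarrow> s x = s y) \<and>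
     (\<forall>x\<in>X. w (alloc x) \<longleftrightarrow> s x \<in> dom h) \<and>
     (\<forall>x\<in>X. \<forall>y\<in>X. w (x \<^bold>\<hookrightarrow> y) \<longleftrightarrow> h (s x) = Some (s y))"

text \<open>The number of cells of \<open>w\<close>, possibly infinite, and \<open>k\<close> have
  the same truncation at \<open>n\<close>.\<close>

definition capped :: "nat \<Rightarrow> ('v fml \<Rightarrow> bool) \<Rightarrow> nat \<Rightarrow> bool" where
  "capped n w k \<longleftrightarrow> (\<forall>m\<le>n. w (size_ge m) \<longleftrightarrow> m \<le> k)"

definition similar :: "'v set \<Rightarrow> nat \<Rightarrow> ('v fml \<Rightarrow> bool) \<Rightarrow> ('v, 'l) store \<Rightarrow> 'l heap \<Rightarrow> bool" where
  "similar X n w s h \<longleftrightarrow> agrees X w s h \<and> capped n w (card (dom h))"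

lemma capped_size_eq:
  fixes w :: "'v::countable fml \<Rightarrow> bool"
  shows "world w \<Longrightarrow> w (size_eq k) \<Longrightarrow> capped n w k"
  by (simp add: capped_def size_eqD)

lemma capped_mono: "capped n w k \<Longrightarrow> m \<le> n \<Longrightarrow> capped m w k"
  by (simp add: capped_def)

text \<open>The sum \<open>min n k1 + min n k2\<close> still reaches every \<open>m \<le> n\<close>
  with \<open>m \<le> k1 + k2\<close>. So truncation survives addition at the same bound, which is
  why a wand does not raise the rank beyond that of its arguments.\<close>

lemma capped_comp:
  fixes w :: "'v::countable fml \<Rightarrow> bool"
  assumes c: "composes w1 w2 w" and "capped n w1 k1" "capped n w2 k2"
  shows "capped n w (k1 + k2)"
  unfolding capped_def
proof (intro allI impI iffI)
  fix m assume m: "m \<le> n" "m \<le> k1 + k2"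
  have "w1 (size_ge (min n k1))" "w2 (size_ge (min n k2))"
    using assms(2,3) unfolding capped_def by simp_all
  then have "w (size_ge (min n k1 + min n k2))"
    by (rule comp_size_add[OF c])
  moreover have "m \<le> min n k1 + min n k2"
    using m by linarith
  ultimately show "w (size_ge m)"
    by (rule size_ge_antimono[OF comp_world(3)[OF c]])
next
  fix m assume m: "m \<le> n" "w (size_ge m)"
  show "m \<le> k1 + k2"
  proof (rule ccontr)
    assume "\<not> m \<le> k1 + k2"
    then have "\<not> w1 (size_ge (Suc k1))" "\<not> w2 (size_ge (Suc k2))" "Suc (k1 + k2) \<le> m"
      using m assms(2,3) unfolding capped_def by auto
    then show False
      using comp_size_less[OF c] size_ge_antimono[OF comp_world(3)[OF c] m(2)] by blast
  qed
qed

lemma disj_heaps_iff: "h1 \<sharp> h2 \<longleftrightarrow> (\<forall>l. l \<in> dom h1 \<longrightarrow> l \<notin> dom h2)"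
  by (auto simp: disj_heaps_def)

lemma disj_heaps_commute: "h1 \<sharp> h2 \<longleftrightarrow> h2 \<sharp> h1"
  by (auto simp: disj_heaps_def)

lemma card_dom_map_add:
  "finite (dom h1) \<Longrightarrow> finite (dom h2) \<Longrightarrow> h1 \<sharp> h2 \<Longrightarrow> card (dom (h1 ++ h2)) = card (dom h1) + card (dom h2)"
  unfolding disj_heaps_def by (simp add: card_Un_disjoint Int_commute Un_commute add.commute)

lemma map_add_eq_Some:
  "h1 \<sharp> h2 \<Longrightarrow> (h1 ++ h2) l = Some l' \<longleftrightarrow> h1 l = Some l' \<or> h2 l = Some l'"
  by (fastforce simp: disj_heaps_def map_add_Some_iff)

lemma restrict_split:
  "h |` D \<sharp> h |` (- D)" "h |` D ++ h |` (- D) = h"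
  by (auto simp: disj_heaps_def map_add_def restrict_map_def fun_eq_iff split: option.split if_splits)

lemma agrees_eq: "agrees X w s h \<Longrightarrow> x \<in> X \<Longrightarrow> y \<in> X \<Longrightarrow> w (x \<^bold>= y) \<longleftrightarrow> s x = s y"
  by (simp add: agrees_def)

lemma agrees_alloc: "agrees X w s h \<Longrightarrow> x \<in> X \<Longrightarrow> w (alloc x) \<longleftrightarrow> s x \<in> dom h"
  by (simp add: agrees_def)

lemma agrees_pto: "agrees X w s h \<Longrightarrow> x \<in> X \<Longrightarrow> y \<in> X \<Longrightarrow> w (x \<^bold>\<hookrightarrow> y) \<longleftrightarrow> h (s x) = Some (s y)"
  by (simp add: agrees_def)

lemma agrees_comp:
  assumes c: "composes w1 w2 w" and a: "agrees X w1 s h1" "agrees X w2 s h2" and d: "h1 \<sharp> h2"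
  shows "agrees X w s (h1 ++ h2)"
  using comp_world(3)[OF c] a
  by (auto simp: agrees_def map_add_eq_Some[OF d] comp_alloc[OF c] comp_pto[OF c] comp_eq[OF c])

text \<open>Disjointness lets the core facts about one part be read off from the whole and the other
  part, for worlds and heaps alike.\<close>

lemma agrees_diff:
  assumes c: "composes w1 w2 w" and a: "agrees X w1 s h1" "agrees X w s (h1 ++ h2)" and d: "h1 \<sharp> h2"
  shows "agrees X w2 s h2"
  unfolding agrees_def
proof (intro conjI ballI)
  show "world w2" "finite (dom h2)"
    using comp_world(2)[OF c] a(2) by (auto simp: agrees_def)
  show "w2 (x \<^bold>= y) \<longleftrightarrow> s x = s y" if "x \<in> X" "y \<in> X" for x y
    using that agrees_eq[OF a(2)] comp_eq(2)[OF c] by simp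
  show alloc: "w2 (alloc x) \<longleftrightarrow> s x \<in> dom h2" if "x \<in> X" for x
    using that agrees_alloc[OF a(1)] agrees_alloc[OF a(2)] comp_alloc[OF c, of x]
      comp_alloc_disjoint[OF c, of x] d by (auto simp: disj_heaps_iff)
  show "w2 (x \<^bold>\<hookrightarrow> y) \<longleftrightarrow> h2 (s x) = Some (s y)" if "x \<in> X" "y \<in> X" for x y
    using that agrees_pto[OF a(1)] agrees_pto[OF a(2)] comp_pto[OF c, of x y] alloc[of x]
      world_pto_alloc[OF comp_world(2)[OF c], of x y] map_add_eq_Some[OF d] d
    by (auto simp: disj_heaps_iff)
qed

lemma agrees_cell:
  fixes w :: "'v::countable fml \<Rightarrow> bool"
  assumes w: "world w" "w (size_eq 1)" "w (alloc x)" and x: "x \<in> X"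
    and eq: "\<forall>x\<in>X. \<forall>y\<in>X. w (x \<^bold>= y) \<longleftrightarrow> s x = s y"
    and pto: "\<forall>y\<in>X. w (x \<^bold>\<hookrightarrow> y) \<longleftrightarrow> l = s y"
  shows "agrees X w s [s x \<mapsto> l]"
  unfolding agrees_def
proof (intro conjI ballI)
  show "w (z \<^bold>= y) \<longleftrightarrow> s z = s y" if "z \<in> X" "y \<in> X" for y z
    using that eq by blast
  show alloc: "w (alloc z) \<longleftrightarrow> s z \<in> dom [s x \<mapsto> l]" if "z \<in> X" for z
    using single_alloc[OF w, of z] that x eq by auto
  show "w (z \<^bold>\<hookrightarrow> y) \<longleftrightarrow> [s x \<mapsto> l] (s z) = Some (s y)" if "z \<in> X" "y \<in> X" for y z
  proof (cases "s z = s x")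
    case True
    then have "w (x \<^bold>= z)"
      using that x eq by simp
    then show ?thesis
      using True pto that world_eq_subst(3)[OF w(1)] by simp
  next
    case False
    then show ?thesis
      using that alloc[of z] world_pto_alloc[OF w(1)] by auto
  qed
qed (use w in auto)

lemma agrees_no_alloc:
  assumes "world w" "finite (dom h)" "\<forall>x\<in>X. \<forall>y\<in>X. w (x \<^bold>= y) \<longleftrightarrow> s x = s y"
    and "\<forall>x\<in>X. \<not> w (alloc x)" "s ` X \<inter> dom h = {}"
  shows "agrees X w s h"
proof -
  have "h (s x) = None" if "x \<in> X" for x
    using assms(5) that by blast
  then show ?thesis
    using assms world_pto_alloc[OF assms(1)] by (auto simp: agrees_def)
qed

section \<open>Adding heaps: the wand\<close>

lemma extend_cell:
  fixes w :: "'v::countable fml \<Rightarrow> bool"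
  assumes "finite X" and a: "agrees X w s h" and l: "l \<notin> dom h"
  shows "\<exists>c u. composes w c u \<and> c (size_eq 1) \<and> agrees X c s [l \<mapsto> l']"
proof -
  have w: "world w"
    using a by (simp add: agrees_def)
  have eq: "\<forall>x\<in>X. \<forall>y\<in>X. c (x \<^bold>= y) \<longleftrightarrow> s x = s y" if "composes w c u" for c u
    using comp_eq[OF that] agrees_eq[OF a] by auto
  show ?thesis
  \<comment> \<open>Over \<open>X\<close> three kinds of cells can be told apart: a cell at a
    location that no variable denotes, whose content is invisible (A21), a cell of a variable with a
    target that some variable denotes (A22), and a cell of a variable with an unnamed target
    (A23).\<close>
  proof (cases "l \<in> s ` X")
    case False
    obtain c u where cu: "composes w c u" "c (size_eq 1)" "\<forall>x\<in>X. \<not> c (alloc x)"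
      by (rule extend_fresh[OF w assms(1)])
    then have "agrees X c s [l \<mapsto> l']"
      using comp_world(2)[OF cu(1)] eq[OF cu(1)] False by (intro agrees_no_alloc) auto
    then show ?thesis
      using cu by blast
  next
    case True
    then obtain x where x: "x \<in> X" "l = s x"
      by blast
    then have na: "\<not> w (alloc x)"
      using agrees_alloc[OF a] l by blast
    have "\<exists>c u. composes w c u \<and> c (size_eq 1) \<and> c (alloc x) \<and> (\<forall>y\<in>X. c (x \<^bold>\<hookrightarrow> y) \<longleftrightarrow> l' = s y)"
    proof (cases "l' \<in> s ` X")
      case True
      then obtain y where y: "y \<in> X" "l' = s y"
        by blast
      obtain c u where cu: "composes w c u" "c (size_eq 1)" "c (x \<^bold>\<hookrightarrow> y)"
        by (rule extend_pto[OF w na])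
      have "c (x \<^bold>\<hookrightarrow> z) \<longleftrightarrow> l' = s z" if "z \<in> X" for z
        using world_pto_iff[OF comp_world(2)[OF cu(1)] cu(3)] eq[OF cu(1)] y that by simp
      then show ?thesis
        using cu world_pto_alloc[OF comp_world(2)[OF cu(1)] cu(3)] by blast
    next
      case False
      obtain c u where cu: "composes w c u" "c (size_eq 1)" "c (alloc x)" "\<forall>y\<in>X. \<not> c (x \<^bold>\<hookrightarrow> y)"
        by (rule extend_dangling[OF w na assms(1)])
      then have "\<forall>y\<in>X. c (x \<^bold>\<hookrightarrow> y) \<longleftrightarrow> l' = s y"
        using False by blast
      then show ?thesis
        using cu by blast
    qed
    then obtain c u where cu: "composes w c u" "c (size_eq 1)" "c (alloc x)"
        "\<forall>y\<in>X. c (x \<^bold>\<hookrightarrow> y) \<longleftrightarrow> l' = s y"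
      by blast
    then have "agrees X c s [l \<mapsto> l']"
      using agrees_cell[OF comp_world(2)[OF cu(1)] cu(2,3) x(1) eq[OF cu(1)] cu(4)] x(2) by simp
    then show ?thesis
      using cu by blast
  qed
qed

lemma unit_agrees:
  fixes w :: "'v::countable fml \<Rightarrow> bool"
  assumes "world w" "\<forall>x\<in>X. \<forall>y\<in>X. w (x \<^bold>= y) \<longleftrightarrow> s x = s y"
  shows "\<exists>e. composes w e w \<and> composes e w w \<and> e (size_eq 0) \<and> agrees X e s Map.empty"
proof -
  obtain e where e: "composes e w w" "e Emp"
    by (rule comp_unit[OF assms(1)])
  have we: "world e"
    by (rule comp_world(1)[OF e(1)])
  have "agrees X e s Map.empty"
    using we emp_not_alloc[OF we e(2)] assms(2) comp_eq(1)[OF e(1)]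
    by (intro agrees_no_alloc) auto
  then show ?thesis
    using e comp_commute[OF e(1)] emp_size[OF we] by blast
qed

text \<open>Building \<open>w1\<close> from single cells fixes its size exactly, so it is correct
  under every cap.\<close>

lemma extend_heap:
  fixes w :: "'v::countable fml \<Rightarrow> bool"
  assumes "finite (dom h1)" and "finite X" and a: "agrees X w s h" and "h1 \<sharp> h"
  shows "\<exists>w1 w2. composes w w1 w2 \<and> w1 (size_eq (card (dom h1))) \<and> agrees X w1 s h1"
  using assms(1,4)
proof (induction h1 rule: finite_Map_induct)
  case empty
  have "world w" "\<forall>x\<in>X. \<forall>y\<in>X. w (x \<^bold>= y) \<longleftrightarrow> s x = s y"
    using a by (auto simp: agrees_def)
  from unit_agrees[OF this] show ?case
    by auto
next
  case (update l l' h1)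
  then have d: "h1 \<sharp> h" "l \<notin> dom (h ++ h1)"
    unfolding disj_heaps_def dom_fun_upd by auto
  from update.IH[OF d(1)] obtain w1 w2
    where w12: "composes w w1 w2" "w1 (size_eq (card (dom h1)))" "agrees X w1 s h1"
    by blast
  \<comment> \<open>The next cell is added to the composite \<open>w2\<close>, which therefore has
    to agree with the whole heap so far; reassociation then merges the cell into
    \<open>w1\<close>.\<close>
  have "agrees X w2 s (h ++ h1)"
    using agrees_comp[OF w12(1) a w12(3)] d(1) disj_heaps_commute by blast
  from extend_cell[OF assms(2) this d(2)] obtain c u
    where cu: "composes w2 c u" "c (size_eq 1)" "agrees X c s [l \<mapsto> l']"
    by blast
  obtain v where v: "composes w1 c v" "composes w v u"
    by (rule comp_assoc[OF w12(1) cu(1)])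
  have "h1 \<sharp> [l \<mapsto> l']"
    using update.hyps by (auto simp: disj_heaps_iff)
  then have "agrees X v s (h1(l \<mapsto> l'))"
    using agrees_comp[OF v(1) w12(3) cu(3)] by (simp del: fun_upd_apply)
  moreover have "card (dom (h1(l \<mapsto> l'))) = card (dom h1) + 1"
    using update.hyps by simp
  then have "v (size_eq (card (dom (h1(l \<mapsto> l')))))"
    using comp_size_eq_add[OF v(1) w12(2) cu(2)] by (simp del: fun_upd_apply)
  ultimately show ?case
    using v(2) by blast
qed

text \<open>The cell that A17 splits off for \<open>x\<close> allocates only variables equal to
  \<open>x\<close>, so all others remain allocated in the rest.\<close>

lemma distinct_alloc_size:
  fixes w :: "'v::countable fml \<Rightarrow> bool"
  assumes "finite Y" "world w" "\<forall>x\<in>Y. w (alloc x)" "\<forall>x\<in>Y. \<forall>y\<in>Y. x \<noteq> y \<longrightarrow> \<not> w (x \<^bold>= y)"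
  shows "w (size_ge (card Y))"
  using assms
proof (induction Y arbitrary: w rule: finite_induct)
  case empty
  then show ?case
    by simp
next
  case (insert x Y)
  obtain c u where cu: "composes c u w" "c (alloc x)" "c (size_eq 1)"
    by (rule alloc_pick[OF insert.prems(1), of x]) (use insert.prems(2) in auto)
  have wc: "world c"
    by (rule comp_world(1)[OF cu(1)])
  have "u (alloc y)" if "y \<in> Y" for y
  proof -
    have "\<not> c (alloc y)"
      using single_alloc[OF wc cu(3,2), of y] comp_eq(1)[OF cu(1)] insert.prems(3) insert.hyps(2) that
      by auto
    then show ?thesis
      using comp_alloc[OF cu(1)] insert.prems(2) that by blast
  qed
  moreover have "\<forall>x\<in>Y. \<forall>y\<in>Y. x \<noteq> y \<longrightarrow> \<not> u (x \<^bold>= y)"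
    using insert.prems(3) comp_eq(2)[OF cu(1)] by simp
  ultimately have "u (size_ge (card Y))"
    using insert.IH[OF comp_world(2)[OF cu(1)]] by blast
  then show ?case
    using comp_size_eq[OF cu(1,3), of "card Y"] insert.hyps by simp
qed

lemma alloc_size:
  fixes w :: "'v::countable fml \<Rightarrow> bool"
  assumes "world w" "finite X" "\<forall>x\<in>X. \<forall>y\<in>X. w (x \<^bold>= y) \<longleftrightarrow> s x = s y"
  shows "w (size_ge (card (s ` {x \<in> X. w (alloc x)})))"
proof -
  obtain Y where Y: "Y \<subseteq> {x \<in> X. w (alloc x)}" "inj_on s Y" "s ` {x \<in> X. w (alloc x)} = s ` Y"
    using subset_image_inj[of "s ` {x \<in> X. w (alloc x)}" s "{x \<in> X. w (alloc x)}"] by auto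
  have "w (size_ge (card Y))"
  proof (rule distinct_alloc_size)
    show "finite Y"
      using Y(1) assms(2) finite_subset by fastforce
    show "\<forall>x\<in>Y. \<forall>y\<in>Y. x \<noteq> y \<longrightarrow> \<not> w (x \<^bold>= y)"
      using Y assms(3) inj_onD[OF Y(2)] by blast
  qed (use assms Y in auto)
  then show ?thesis
    using Y by (simp add: card_image)
qed

lemma size_eq_exists:
  fixes w :: "'v::countable fml \<Rightarrow> bool"
  assumes "world w" "\<not> w (size_ge n)"
  shows "\<exists>m<n. w (size_eq m)"
  using assms(2)
proof (induction n)
  case 0
  then show ?case
    using assms(1) by simp
next
  case (Suc n)
  then show ?case
    using size_eq_iff[OF assms(1), of n] less_Suc_eq by blast
qed

text \<open>A world that reaches \<open>n\<close> may have no exact size, but then any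
  \<open>m \<ge> n\<close> is correct, and \<open>max n k\<close> also respects the lower bound
  \<open>k\<close>. In the uses \<open>k\<close> counts cells forced by variables.\<close>

lemma capped_exists:
  fixes w :: "'v::countable fml \<Rightarrow> bool"
  assumes "world w" "w (size_ge k)"
  shows "\<exists>m\<ge>k. capped n w m"
proof (cases "w (size_ge n)")
  case True
  then have "capped n w (max n k)"
    using size_ge_antimono[OF assms(1) True] by (auto simp: capped_def)
  then show ?thesis
    using max.cobounded2 by blast
next
  case False
  then obtain m where m: "w (size_eq m)"
    using size_eq_exists[OF assms(1)] by blast
  then show ?thesis
    using size_eqD[OF assms(1) m, of k] assms(2) capped_size_eq[OF assms(1) m] by blast
qed

text \<open>The heap \<open>h1\<close> has the cells \<open>A\<close> that \<open>w1\<close>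
  allocates at variables, padded with cells \<open>L\<close> up to a size that \<open>w1\<close>
  cannot tell from its own below the bound. Infinitely many locations keep \<open>L\<close> away
  from \<open>h\<close> and from the values of \<open>X\<close>.\<close>

lemma extend_world:
  fixes w :: "'v::countable fml \<Rightarrow> bool" and s :: "('v, 'l::infinite) store"
  assumes c: "composes w w1 w2" and sim: "similar X n w s h" and X: "finite X"
  shows "\<exists>h1. finite (dom h1) \<and> h1 \<sharp> h \<and> similar X n w1 s h1 \<and> similar X n w2 s (h ++ h1)"
proof -
  have a: "agrees X w s h" and cap: "capped n w (card (dom h))"
    using sim by (auto simp: similar_def)
  have w1: "world w1"
    by (rule comp_world(2)[OF c])
  have fin: "finite (dom h)"
    using a by (simp add: agrees_def)
  have eq: "w1 (x \<^bold>= y) \<longleftrightarrow> s x = s y" if "x \<in> X" "y \<in> X" for x y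
    using agrees_eq[OF a that] comp_eq[OF c] by simp
  define A where "A = s ` {x \<in> X. w1 (alloc x)}"
  have A: "s x \<in> A \<longleftrightarrow> w1 (alloc x)" if "x \<in> X" for x
  proof
    assume "s x \<in> A"
    then obtain y where "y \<in> X" "w1 (alloc y)" "s x = s y"
      by (auto simp: A_def)
    then show "w1 (alloc x)"
      using world_eq_subst(5)[OF w1, of x y] eq that by simp
  qed (use that in \<open>auto simp: A_def\<close>)
  have finA: "finite A"
    using X by (simp add: A_def)
  have "w1 (size_ge (card A))"
    unfolding A_def using alloc_size[OF w1 X] eq by blast
  then obtain m where m: "card A \<le> m" "capped n w1 m"
    using capped_exists[OF w1] by blast
  have "infinite (UNIV - (dom h \<union> s ` X))"
    using fin X by (simp add: Diff_infinite_finite infinite_UNIV)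
  from infinite_arbitrarily_large[OF this, of "m - card A"]
  obtain L where L: "finite L" "card L = m - card A" "L \<subseteq> UNIV - (dom h \<union> s ` X)"
    by blast
  \<comment> \<open>A target that no variable in \<open>X\<close> denotes: padding cells and cells
    of \<open>w1\<close> with unnamed content point here.\<close>
  obtain l0 where l0: "l0 \<notin> s ` X"
    using ex_new_if_finite[OF infinite_UNIV finite_imageI[OF X]] by blast
  \<comment> \<open>Targets are chosen for locations, since several variables may denote the same
    one; A4 makes the chosen target unique among the values of \<open>X\<close>.\<close>
  define P where "P l l' \<longleftrightarrow> (\<exists>x\<in>X. \<exists>y\<in>X. s x = l \<and> s y = l' \<and> w1 (x \<^bold>\<hookrightarrow> y))" for l l'
  define v where "v l = (if \<exists>l'. P l l' then SOME l'. P l l' else l0)" for l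
  have P: "P (s x) (s y) \<longleftrightarrow> w1 (x \<^bold>\<hookrightarrow> y)" if "x \<in> X" "y \<in> X" for x y
  proof
    assume "P (s x) (s y)"
    then obtain x' y' where "x' \<in> X" "y' \<in> X" "s x' = s x" "s y' = s y" "w1 (x' \<^bold>\<hookrightarrow> y')"
      by (auto simp: P_def)
    then show "w1 (x \<^bold>\<hookrightarrow> y)"
      using world_eq_subst(3)[OF w1, of x x'] world_eq_subst(4)[OF w1, of y y'] eq that by simp
  qed (use that in \<open>auto simp: P_def\<close>)
  have v: "v (s x) = s y \<longleftrightarrow> w1 (x \<^bold>\<hookrightarrow> y)" if x: "x \<in> X" and y: "y \<in> X" for x y
  proof (cases "\<exists>l'. P (s x) l'")
    case True
    then have "P (s x) (v (s x))"
      unfolding v_def by (simp add: someI_ex)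
    moreover from this obtain z where z: "z \<in> X" "v (s x) = s z"
      unfolding P_def by metis
    ultimately have "w1 (x \<^bold>\<hookrightarrow> z)"
      using P[OF x z(1)] by simp
    then show ?thesis
      using z eq[OF z(1) y] world_pto_iff[OF w1, of x z y] by simp
  next
    case False
    then show ?thesis
      using P[OF x y] l0 y by (auto simp: v_def)
  qed
  define h1 where "h1 l = (if l \<in> A then Some (v l) else if l \<in> L then Some l0 else None)" for l
  have dom: "dom h1 = A \<union> L"
    by (auto simp: h1_def dom_def)
  have "A \<inter> dom h = {}"
    using agrees_alloc[OF a] comp_alloc_disjoint[OF c] by (auto simp: A_def)
  then have d: "h1 \<sharp> h"
    using L(3) unfolding disj_heaps_def dom by blast
  have "A \<inter> L = {}"
    using L(3) by (auto simp: A_def)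
  then have card: "card (dom h1) = m"
    using finA L(1,2) m(1) by (simp add: dom card_Un_disjoint)
  have L': "s x \<notin> L" if "x \<in> X" for x
    using L(3) that by blast
  have a1: "agrees X w1 s h1"
    unfolding agrees_def
  proof (intro conjI ballI)
    show "w1 (x \<^bold>\<hookrightarrow> y) \<longleftrightarrow> h1 (s x) = Some (s y)" if "x \<in> X" "y \<in> X" for x y
      using v[OF that] A[OF that(1)] L'[OF that(1)] world_pto_alloc[OF w1, of x y] by (auto simp: h1_def)
  qed (use w1 eq A L' finA L(1) dom in auto)
  have "h \<sharp> h1"
    using d disj_heaps_commute by blast
  then have "agrees X w2 s (h ++ h1)" "card (dom (h ++ h1)) = card (dom h) + m"
    using agrees_comp[OF c a a1] card_dom_map_add[OF fin, of h1] card finA L(1) dom by auto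
  then show ?thesis
    using a1 m(2) card d capped_comp[OF c cap m(2)] finA L(1) dom unfolding similar_def
    by (intro exI[of _ h1]) simp
qed

section \<open>Splitting heaps: the star\<close>

lemma agrees_restrict:
  assumes c: "composes w1 w2 w" and a: "agrees X w s h"
    and D: "\<forall>x\<in>X. w1 (alloc x) \<longleftrightarrow> s x \<in> D" "D \<subseteq> dom h"
  shows "agrees X w1 s (h |` D)" "agrees X w2 s (h |` (- D))"
proof -
  show *: "agrees X w1 s (h |` D)"
    unfolding agrees_def
  proof (intro conjI ballI)
    show "w1 (x \<^bold>\<hookrightarrow> y) \<longleftrightarrow> (h |` D) (s x) = Some (s y)" if "x \<in> X" "y \<in> X" for x y
      using that D agrees_pto[OF a that] comp_pto[OF c, of x y] world_pto_alloc[OF comp_world(1)[OF c], of x y]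
        world_pto_alloc[OF comp_world(2)[OF c], of x y] comp_alloc_disjoint[OF c, of x]
      by (auto simp: restrict_map_def)
    show "finite (dom (h |` D))"
      using a by (simp add: agrees_def)
  qed (use comp_world(1)[OF c] comp_eq(1)[OF c] agrees_eq[OF a] D in auto)
  show "agrees X w2 s (h |` (- D))"
    using agrees_diff[OF c * _ restrict_split(1)] a by (simp add: restrict_split(2))
qed

text \<open>A part below \<open>n1\<close> has an exact size \<open>m\<close> and receives
  \<open>m - k1\<close> free cells. The other part then reaches \<open>n2\<close> in the world
  because \<open>m + n2 \<le> n1 + n2\<close>, and in the heap because at least \<open>n2\<close> of
  the \<open>r\<close> free cells are left.\<close>

lemma capped_split_small:
  fixes w :: "'v::countable fml \<Rightarrow> bool"
  assumes c: "composes w1 w2 w" and w: "w (size_ge (n1 + n2))" "n1 + n2 \<le> r"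
    and w1: "w1 (size_ge k1)" "\<not> w1 (size_ge n1)"
  shows "\<exists>t\<le>r. capped n1 w1 (k1 + t) \<and> capped n2 w2 (k2 + (r - t))"
proof -
  note wd = comp_world[OF c]
  obtain m where m: "m < n1" "w1 (size_eq m)"
    using size_eq_exists[OF wd(1) w1(2)] by blast
  have "k1 \<le> m"
    using size_eqD[OF wd(1) m(2)] w1(1) by blast
  then have "capped n1 w1 (k1 + (m - k1))"
    using capped_size_eq[OF wd(1) m(2)] by simp
  moreover have "w2 (size_ge j)" if "j \<le> n2" for j
    using comp_size_eq[OF c m(2), of j] size_ge_antimono[OF wd(3) w(1), of "m + j"] m(1) that by simp
  then have "capped n2 w2 (k2 + (r - (m - k1)))"
    using m(1) w(2) unfolding capped_def by auto
  moreover have "m - k1 \<le> r"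
    using m(1) w(2) by linarith
  ultimately show ?thesis
    by blast
qed

text \<open>Here \<open>k1\<close> and \<open>k2\<close> count cells whose side is prescribed, and
  \<open>r\<close> the free ones, \<open>t\<close> of which go to the first part. There are at most
  \<open>N\<close> prescribed cells, so a total of \<open>n1 + n2 + N\<close> guarantees
  \<open>n1 + n2\<close> free ones, enough to bring both parts to their bounds.\<close>

lemma capped_split:
  fixes w :: "'v::countable fml \<Rightarrow> bool"
  assumes c: "composes w1 w2 w" and cap: "capped (n1 + n2 + N) w (k1 + k2 + r)"
    and k: "w1 (size_ge k1)" "w2 (size_ge k2)" "k1 + k2 \<le> N"
  shows "\<exists>t\<le>r. capped n1 w1 (k1 + t) \<and> capped n2 w2 (k2 + (r - t))"
proof -
  note wd = comp_world[OF c]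
  \<comment> \<open>Either the total is below the cap and all sizes are exact, or one part is below
    its own bound, or both have reached theirs and \<open>t = n1\<close> works.\<close>
  consider "k1 + k2 + r < n1 + n2 + N"
    | "n1 + n2 + N \<le> k1 + k2 + r" "\<not> w1 (size_ge n1)"
    | "n1 + n2 + N \<le> k1 + k2 + r" "\<not> w2 (size_ge n2)"
    | "n1 + n2 + N \<le> k1 + k2 + r" "w1 (size_ge n1)" "w2 (size_ge n2)"
    by linarith
  then show ?thesis
  proof cases
    case 1
    then have w: "w (size_ge (k1 + k2 + r))" "\<not> w (size_ge (Suc (k1 + k2 + r)))"
      using cap unfolding capped_def by auto
    then have "\<not> w1 (size_ge (Suc (k1 + k2 + r)))"
      using comp_size_mono[OF c] by blast
    then obtain m where m: "m < Suc (k1 + k2 + r)" "w1 (size_eq m)"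
      using size_eq_exists[OF wd(1)] by blast
    have "k1 \<le> m"
      using size_eqD[OF wd(1) m(2)] k(1) by blast
    have w2: "w2 (size_eq (k1 + k2 + r - m))"
      using comp_size_eq[OF c m(2), of "k1 + k2 + r - m"] comp_size_eq[OF c m(2), of "Suc (k1 + k2 + r - m)"]
        w m(1) by (simp add: size_eq_iff[OF wd(2)])
    then have "k2 \<le> k1 + k2 + r - m"
      using size_eqD[OF wd(2)] k(2) by blast
    then have "m - k1 \<le> r" "k1 + (m - k1) = m" "k2 + (r - (m - k1)) = k1 + k2 + r - m"
      using \<open>k1 \<le> m\<close> m(1) by linarith+
    then show ?thesis
      using capped_size_eq[OF wd(1) m(2)] capped_size_eq[OF wd(2) w2] by metis
  next
    case 2
    then have "w (size_ge (n1 + n2 + N))"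
      using cap by (simp add: capped_def)
    then have "w (size_ge (n1 + n2))"
      by (rule size_ge_antimono[OF wd(3)]) simp
    with 2 k show ?thesis
      by (intro capped_split_small[OF c]) auto
  next
    case 3
    then have "w (size_ge (n1 + n2 + N))"
      using cap by (simp add: capped_def)
    then have "w (size_ge (n2 + n1))"
      by (rule size_ge_antimono[OF wd(3)]) simp
    with 3 k have "\<exists>t\<le>r. capped n2 w2 (k2 + t) \<and> capped n1 w1 (k1 + (r - t))"
      by (intro capped_split_small[OF comp_commute[OF c]]) auto
    then obtain t where "t \<le> r" "capped n2 w2 (k2 + t)" "capped n1 w1 (k1 + (r - t))"
      by blast
    then show ?thesis
      by (intro exI[of _ "r - t"]) simp
  next
    case 4
    then have "capped n1 w1 (k1 + n1)" "capped n2 w2 (k2 + (r - n1))" "n1 \<le> r"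
      using k(3) size_ge_antimono[OF wd(1) 4(2)] size_ge_antimono[OF wd(2) 4(3)]
      unfolding capped_def by auto
    then show ?thesis
      by blast
  qed
qed

text \<open>Cells at locations of variables go to the part that allocates them, and there are at
  most \<open>card X\<close> of these. The remaining cells \<open>R\<close> look alike over
  \<open>X\<close>, so only the number given to each side matters.\<close>

lemma split_heap:
  fixes w :: "'v::countable fml \<Rightarrow> bool"
  assumes c: "composes w1 w2 w" and sim: "similar X (n1 + n2 + card X) w s h" and X: "finite X"
  shows "\<exists>h1 h2. h1 \<sharp> h2 \<and> h1 ++ h2 = h \<and> similar X n1 w1 s h1 \<and> similar X n2 w2 s h2"
proof -
  have a: "agrees X w s h" and cap: "capped (n1 + n2 + card X) w (card (dom h))"
    using sim by (auto simp: similar_def)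
  note wd = comp_world[OF c]
  have fin: "finite (dom h)"
    using a by (simp add: agrees_def)
  have eq: "\<forall>x\<in>X. \<forall>y\<in>X. w1 (x \<^bold>= y) \<longleftrightarrow> s x = s y" "\<forall>x\<in>X. \<forall>y\<in>X. w2 (x \<^bold>= y) \<longleftrightarrow> s x = s y"
    using agrees_eq[OF a] comp_eq[OF c] by auto
  define A1 where "A1 = s ` {x \<in> X. w1 (alloc x)}"
  define A2 where "A2 = s ` {x \<in> X. w2 (alloc x)}"
  have A1: "s x \<in> A1 \<longleftrightarrow> w1 (alloc x)" if "x \<in> X" for x
    using that eq(1) world_eq_subst(5)[OF wd(1)] unfolding A1_def by (auto 4 4)
  have A2: "s x \<in> A2 \<longleftrightarrow> w2 (alloc x)" if "x \<in> X" for x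
    using that eq(2) world_eq_subst(5)[OF wd(2)] unfolding A2_def by (auto 4 4)
  have "A1 \<union> A2 = dom h \<inter> s ` X"
    using agrees_alloc[OF a] comp_alloc[OF c] unfolding A1_def A2_def by auto
  moreover have disj: "A1 \<inter> A2 = {}"
    using A1 A2 comp_alloc_disjoint[OF c] unfolding A1_def by auto
  moreover define R where "R = dom h - s ` X"
  ultimately have dom: "dom h = A1 \<union> A2 \<union> R" and R: "(A1 \<union> A2) \<inter> R = {}"
    and A: "A1 \<union> A2 \<subseteq> s ` X"
    by blast+
  have finA: "finite A1" "finite A2" "finite R"
    using fin dom by auto
  have "card (A1 \<union> A2) \<le> card X"
    using A X card_image_le[OF X, of s] card_mono[of "s ` X" "A1 \<union> A2"] by simp
  then have cardA: "card A1 + card A2 \<le> card X"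
    using finA disj by (simp add: card_Un_disjoint)
  have cardh: "card (dom h) = card A1 + card A2 + card R"
    using finA disj R by (simp add: dom card_Un_disjoint)
  have "w1 (size_ge (card A1))" "w2 (size_ge (card A2))"
    unfolding A1_def A2_def by (fact alloc_size[OF wd(1) X eq(1)] alloc_size[OF wd(2) X eq(2)])+
  from capped_split[OF c _ this cardA, of n1 n2 "card R"] cap cardh
  obtain t where t: "t \<le> card R" "capped n1 w1 (card A1 + t)" "capped n2 w2 (card A2 + (card R - t))"
    by auto
  obtain T where T: "T \<subseteq> R" "card T = t" "finite T"
    using obtain_subset_with_card_n[OF t(1)] by blast
  define D where "D = A1 \<union> T"
  have D: "\<forall>x\<in>X. w1 (alloc x) \<longleftrightarrow> s x \<in> D" "D \<subseteq> dom h"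
    using A1 T(1) dom unfolding D_def R_def by auto
  have "dom (h |` D) = A1 \<union> T" "dom (h |` (- D)) = A2 \<union> (R - T)"
    using dom disj R T(1) unfolding D_def by auto
  moreover have "card (A1 \<union> T) = card A1 + t"
    using finA(1) T R by (subst card_Un_disjoint) auto
  moreover have "card (A2 \<union> (R - T)) = card A2 + (card R - t)"
    using finA T R by (subst card_Un_disjoint) (auto simp: card_Diff_subset)
  ultimately have "similar X n1 w1 s (h |` D)" "similar X n2 w2 s (h |` (- D))"
    using agrees_restrict[OF c a D] t unfolding similar_def by simp_all
  then show ?thesis
    using restrict_split by blast
qed

text \<open>The counterpart, on the side of worlds, of restricting a heap to locations of variables:
  A17 removes one cell per location. The removed part has an exact size, so it can be subtracted
  afterwards.\<close>

lemma split_alloc: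
  fixes w :: "'v::countable fml \<Rightarrow> bool"
  assumes "finite (dom h0)" and "dom h0 \<subseteq> s ` X" "h0 \<sharp> h" "agrees X w s (h0 ++ h)"
  shows "\<exists>w0 u. composes w0 u w \<and> agrees X w0 s h0 \<and> w0 (size_eq (card (dom h0))) \<and> agrees X u s h"
  using assms
proof (induction h0 arbitrary: w rule: finite_Map_induct)
  case empty
  have "world w" "\<forall>x\<in>X. \<forall>y\<in>X. w (x \<^bold>= y) \<longleftrightarrow> s x = s y"
    using empty.prems(3) by (auto simp: agrees_def)
  from unit_agrees[OF this] show ?case
    using empty.prems(3) by auto
next
  case (update l l' h0)
  let ?c = "[l \<mapsto> l']"
  have a: "agrees X w s (?c ++ (h0 ++ h))" and d: "?c \<sharp> (h0 ++ h)" "?c \<sharp> h0" "h0 \<sharp> h"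
  proof -
    have "h0(l \<mapsto> l') = ?c ++ h0"
      using update.hyps by (auto simp: map_add_def fun_eq_iff split: option.split)
    then show "agrees X w s (?c ++ (h0 ++ h))"
      using update.prems(3) by (simp del: fun_upd_apply)
    show "?c \<sharp> (h0 ++ h)" "?c \<sharp> h0" "h0 \<sharp> h"
      using update.prems(2) update.hyps unfolding disj_heaps_def dom_fun_upd by auto
  qed
  obtain x where x: "x \<in> X" "l = s x"
    using update.prems(1) unfolding dom_fun_upd by auto
  have w: "world w"
    using a by (simp add: agrees_def)
  have "w (alloc x)"
    using agrees_alloc[OF a x(1)] x(2) by simp
  then obtain c u where cu: "composes c u w" "c (alloc x)" "c (size_eq 1)"
    by (rule alloc_pick[OF w])
  \<comment> \<open>A17 leaves open where the cell points. Since the rest \<open>u\<close> does not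
    allocate \<open>x\<close>, every pointer of \<open>x\<close> in \<open>w\<close> stems from
    \<open>c\<close>, and \<open>w\<close> agrees with the heap.\<close>
  have "agrees X c s [s x \<mapsto> l']"
  proof (rule agrees_cell[OF comp_world(1)[OF cu(1)] cu(3,2) x(1)])
    show "\<forall>x\<in>X. \<forall>y\<in>X. c (x \<^bold>= y) \<longleftrightarrow> s x = s y"
      using agrees_eq[OF a] comp_eq[OF cu(1)] by auto
    have "\<not> u (x \<^bold>\<hookrightarrow> y)" for y
      using comp_alloc_disjoint[OF cu(1,2)] world_pto_alloc[OF comp_world(2)[OF cu(1)], of x y] by blast
    then show "\<forall>y\<in>X. c (x \<^bold>\<hookrightarrow> y) \<longleftrightarrow> l' = s y"
      using comp_pto[OF cu(1), of x] agrees_pto[OF a x(1)] map_add_eq_Some[OF d(1), of "s x"] d(1) x(2)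
      by (auto simp: disj_heaps_iff)
  qed
  then have c: "agrees X c s ?c"
    using x(2) by simp
  have "agrees X u s (h0 ++ h)"
    by (rule agrees_diff[OF cu(1) c a d(1)])
  moreover have "dom h0 \<subseteq> s ` X"
    using update.prems(1) unfolding dom_fun_upd by auto
  ultimately obtain w0 v where v: "composes w0 v u" "agrees X w0 s h0" "w0 (size_eq (card (dom h0)))" "agrees X v s h"
    using update.IH[OF _ d(3)] by blast
  obtain w1 where w1: "composes c w0 w1" "composes w1 v w"
    by (rule comp_assoc'[OF v(1) cu(1)])
  have "?c ++ h0 = h0(l \<mapsto> l')"
    using update.hyps by (auto simp: map_add_def fun_eq_iff split: option.split)
  then have "agrees X w1 s (h0(l \<mapsto> l'))"
    using agrees_comp[OF w1(1) c v(2) d(2)] by (simp del: fun_upd_apply)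
  moreover have "card (dom (h0(l \<mapsto> l'))) = 1 + card (dom h0)"
    using update.hyps by simp
  then have "w1 (size_eq (card (dom (h0(l \<mapsto> l')))))"
    using comp_size_eq_add[OF w1(1) cu(3) v(3)] by (simp del: fun_upd_apply)
  ultimately show ?case
    using w1(2) v(4) by blast
qed

lemma split_size:
  fixes w :: "'v::countable fml \<Rightarrow> bool"
  assumes "world w" "w (size_ge n)"
  shows "\<exists>p q. composes p q w \<and> p (size_eq n)"
  using assms
proof (induction n arbitrary: w)
  case 0
  obtain e where e: "composes e w w" "e Emp"
    by (rule comp_unit[OF 0(1)])
  then show ?case
    using emp_size[OF comp_world(1)[OF e(1)]] by blast
next
  case (Suc n)
  have "\<not> w Emp"
    using size_ge_antimono[OF Suc.prems, of 1] Suc.prems(1) by simp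
  then obtain c u where cu: "composes c u w" "c (size_eq 1)"
    by (rule size_pick[OF Suc.prems(1)])
  have "u (size_ge n)"
    using comp_size_eq[OF cu, of n] Suc.prems(2) by simp
  then obtain p q where pq: "composes p q u" "p (size_eq n)"
    using Suc.IH[OF comp_world(2)[OF cu(1)]] by blast
  obtain v where v: "composes c p v" "composes v q w"
    by (rule comp_assoc'[OF pq(1) cu(1)])
  then have "v (size_eq (1 + n))"
    using comp_size_eq_add[OF v(1) cu(2) pq(2)] by blast
  then show ?case
    using v(2) by auto
qed

text \<open>If one of the numbers is within its bound, exactly that many cells are split off and the
  size of the rest follows by subtraction.\<close>

lemma split_capped:
  fixes w :: "'v::countable fml \<Rightarrow> bool"
  assumes w: "world w" and cap: "capped (n1 + n2) w (k1 + k2)"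
  shows "\<exists>p q. composes p q w \<and> capped n1 p k1 \<and> capped n2 q k2"
proof -
  have *: "\<exists>p q. composes p q w \<and> capped n1 p k1 \<and> capped n2 q k2"
    if "k1 \<le> n1" and cap: "capped (n1 + n2) w (k1 + k2)" for n1 n2 k1 k2
  proof -
    have "w (size_ge k1)"
      using that by (simp add: capped_def)
    then obtain p q where pq: "composes p q w" "p (size_eq k1)"
      using split_size[OF w] by blast
    have "capped n2 q k2"
      using comp_size_eq[OF pq] cap \<open>k1 \<le> n1\<close> unfolding capped_def
      by (metis add_le_cancel_left add_mono)
    then show ?thesis
      using pq capped_size_eq[OF comp_world(1)[OF pq(1)] pq(2)] by blast
  qed
  consider "k1 \<le> n1" | "k2 \<le> n2" | "n1 \<le> k1" "n2 \<le> k2"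
    by linarith
  then show ?thesis
  proof cases
    case 1
    then show ?thesis
      using cap by (rule *)
  next
    case 2
    then have "\<exists>q p. composes q p w \<and> capped n2 q k2 \<and> capped n1 p k1"
      using *[of k2 n2 n1 k1] cap by (simp add: add.commute)
    then show ?thesis
      using comp_commute by blast
  next
    case 3
    \<comment> \<open>Beyond both bounds the numbers are invisible and may be lowered to the bounds,
      which is the situation treated before.\<close>
    then have "capped (n1 + n2) w (n1 + n2)"
      using cap by (simp add: capped_def)
    from *[OF order_refl this] obtain p q where pq: "composes p q w" "capped n1 p n1" "capped n2 q n2"
      by blast
    then have "capped n1 p k1" "capped n2 q k2"
      using 3 unfolding capped_def by auto
    then show ?thesis
      using pq(1) by blast
  qed
qed

text \<open>The cells at locations of variables, \<open>a1\<close> and \<open>a2\<close>, are first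
  removed from \<open>w\<close>. The remainder allocates no variable of \<open>X\<close> and can be
  divided by size alone; its halves are then joined with the variable cells of their side.\<close>

lemma split_world:
  fixes w :: "'v::countable fml \<Rightarrow> bool"
  assumes sim: "similar X (n1 + n2 + card X) w s (h1 ++ h2)" and d: "h1 \<sharp> h2" and X: "finite X"
  shows "\<exists>w1 w2. composes w1 w2 w \<and> similar X n1 w1 s h1 \<and> similar X n2 w2 s h2"
proof -
  define a1 where "a1 = h1 |` (s ` X)"
  define b1 where "b1 = h1 |` (- s ` X)"
  define a2 where "a2 = h2 |` (s ` X)"
  define b2 where "b2 = h2 |` (- s ` X)"
  have a: "agrees X w s (h1 ++ h2)" and cap: "capped (n1 + n2 + card X) w (card (dom (h1 ++ h2)))"
    using sim by (auto simp: similar_def)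
  have fin: "finite (dom h1)" "finite (dom h2)"
    using a by (auto simp: agrees_def)
  then have fin': "finite (dom a1)" "finite (dom b1)" "finite (dom a2)" "finite (dom b2)"
    by (auto simp: a1_def b1_def a2_def b2_def)
  have h1: "a1 \<sharp> b1" "a1 ++ b1 = h1" and h2: "a2 \<sharp> b2" "a2 ++ b2 = h2"
    unfolding a1_def b1_def a2_def b2_def by (rule restrict_split)+
  have X1: "dom a1 \<subseteq> s ` X" "dom a2 \<subseteq> s ` X" "dom b1 \<inter> s ` X = {}" "dom b2 \<inter> s ` X = {}"
    unfolding a1_def b1_def a2_def b2_def by auto
  have dd: "a1 \<sharp> (a2 ++ (b1 ++ b2))" "a2 \<sharp> (b1 ++ b2)" "b1 \<sharp> b2" "dom a1 \<inter> dom a2 = {}"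
    using d X1 h1 h2 unfolding disj_heaps_def dom_map_add h1(2)[symmetric] h2(2)[symmetric] by blast+
  have "b1 ++ a2 = a2 ++ b1"
    using d unfolding disj_heaps_def dom_map_add h1(2)[symmetric] h2(2)[symmetric]
    by (intro map_add_comm) blast
  then have eqh: "h1 ++ h2 = a1 ++ (a2 ++ (b1 ++ b2))"
    unfolding h1(2)[symmetric] h2(2)[symmetric] by (metis map_add_assoc)
  from split_alloc[OF fin'(1) X1(1) dd(1)] a eqh obtain u1 v1
    where u1: "composes u1 v1 w" "agrees X u1 s a1" "u1 (size_eq (card (dom a1)))" "agrees X v1 s (a2 ++ (b1 ++ b2))"
    by metis
  from split_alloc[OF fin'(3) X1(2) dd(2) u1(4)] obtain u2 v2
    where u2: "composes u2 v2 v1" "agrees X u2 s a2" "u2 (size_eq (card (dom a2)))" "agrees X v2 s (b1 ++ b2)"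
    by blast
  have "card (dom a1) + card (dom a2) \<le> card X"
  proof -
    have "card (dom a1 \<union> dom a2) \<le> card (s ` X)"
      using X X1 by (intro card_mono) auto
    then show ?thesis
      using card_image_le[OF X, of s] fin' dd(4) by (simp add: card_Un_disjoint)
  qed
  moreover have "card (dom (h1 ++ h2)) = card (dom a1) + card (dom a2) + (card (dom b1) + card (dom b2))"
  proof -
    have "finite (dom (b1 ++ b2))" "finite (dom (a2 ++ (b1 ++ b2)))"
      using fin' by simp_all
    then show ?thesis
      unfolding eqh
      using card_dom_map_add[OF fin'(1) _ dd(1)] card_dom_map_add[OF fin'(3) _ dd(2)]
        card_dom_map_add[OF fin'(2,4) dd(3)] by linarith
  qed
  moreover have "v2 (size_ge m) \<longleftrightarrow> w (size_ge (card (dom a1) + (card (dom a2) + m)))" for m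
    using comp_size_eq[OF u1(1,3)] comp_size_eq[OF u2(1,3)] by simp
  \<comment> \<open>The removed variable cells have an exact number, at most \<open>card X\<close>,
    so the cap \<open>n1 + n2 + card X\<close> of \<open>w\<close> leaves \<open>n1 + n2\<close> for
    \<open>v2\<close>.\<close>
  ultimately have "capped (n1 + n2) v2 (card (dom b1) + card (dom b2))"
    using cap unfolding capped_def by simp
  then obtain p1 p2 where p: "composes p1 p2 v2" "capped n1 p1 (card (dom b1))" "capped n2 p2 (card (dom b2))"
    using split_capped[OF comp_world(2)[OF u2(1)]] by blast
  have b: "agrees X p s b" if "world p" "p = p1 \<or> p = p2" "b = b1 \<or> b = b2" for p b
  proof (rule agrees_no_alloc[OF that(1)])
    show "\<forall>x\<in>X. \<forall>y\<in>X. p (x \<^bold>= y) \<longleftrightarrow> s x = s y"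
      using that(2) comp_eq[OF p(1)] agrees_eq[OF u2(4)] by auto
    have "s x \<notin> dom (b1 ++ b2)" if "x \<in> X" for x
      using X1(3,4) that unfolding dom_map_add by blast
    then show "\<forall>x\<in>X. \<not> p (alloc x)"
      using that(2) comp_alloc[OF p(1)] agrees_alloc[OF u2(4)] by auto
  qed (use that(3) fin' X1 in auto)
  \<comment> \<open>Exchanges \<open>u2\<close> and \<open>p1\<close>: \<open>v1\<close> is
    regrouped as \<open>p1\<close> composed with the composite of \<open>u2\<close> and
    \<open>p2\<close>, so that \<open>p1\<close> can join \<open>u1\<close>.\<close>
  obtain v2' where v2': "composes u2 p2 v2'" "composes p1 v2' v1"
  proof -
    obtain z where z: "composes p2 u2 z" "composes p1 z v1"
      by (rule comp_assoc[OF p(1) comp_commute[OF u2(1)]])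
    then show thesis
      using that comp_commute by blast
  qed
  obtain w1 where w1: "composes u1 p1 w1" "composes w1 v2' w"
    by (rule comp_assoc'[OF v2'(2) u1(1)])
  have "agrees X w1 s h1" "agrees X v2' s h2"
    using agrees_comp[OF w1(1) u1(2) b[OF comp_world(2)[OF w1(1)] disjI1[OF refl] disjI1[OF refl]] h1(1)]
      agrees_comp[OF v2'(1) u2(2) b[OF comp_world(2)[OF v2'(1)] disjI2[OF refl] disjI2[OF refl]] h2(1)] h1(2) h2(2) by auto
  moreover have "capped n1 w1 (card (dom h1))" "capped n2 v2' (card (dom h2))"
    using capped_comp[OF w1(1) capped_size_eq[OF comp_world(1)[OF w1(1)] u1(3)] p(2)]
      capped_comp[OF v2'(1) capped_size_eq[OF comp_world(1)[OF v2'(1)] u2(3)] p(3)]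
      card_dom_map_add[OF fin'(1,2) h1(1)] card_dom_map_add[OF fin'(3,4) h2(1)] h1(2) h2(2) by auto
  ultimately show ?thesis
    using w1(2) unfolding similar_def by blast
qed

text \<open>The summand \<open>N\<close> for the separating conjunction pays for the cells allocated by
  variables: which part they belong to is prescribed, so they need not count towards the sizes
  \<open>rank N \<phi>\<close> and \<open>rank N \<psi>\<close> of the parts.\<close>

primrec rank :: "nat \<Rightarrow> 'v fml \<Rightarrow> nat" where
  "rank N (x \<^bold>= y) = 0"
| "rank N (x \<^bold>\<hookrightarrow> y) = 0"
| "rank N Emp = 1"
| "rank N (\<^bold>\<not> \<phi>) = rank N \<phi>"
| "rank N (\<phi> \<^bold>\<and> \<psi>) = max (rank N \<phi>) (rank N \<psi>)"
| "rank N (\<phi> \<^bold>* \<psi>) = rank N \<phi> + rank N \<psi> + N"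
| "rank N (\<phi> \<^bold>-* \<psi>) = max (rank N \<phi>) (rank N \<psi>)"

lemma similar_mono: "similar X n w s h \<Longrightarrow> m \<le> n \<Longrightarrow> similar X m w s h"
  unfolding similar_def using capped_mono by blast

text \<open>The bound \<open>n\<close> varies in the induction: a star passes to the smaller bounds
  of its arguments, by \<open>split_heap\<close> and \<open>split_world\<close>, while a wand goes
  on with the same \<open>n\<close>, by \<open>extend_heap\<close> and
  \<open>extend_world\<close>.\<close>

lemma truth_lemma:
  fixes w :: "'v::countable fml \<Rightarrow> bool" and s :: "('v, 'l::infinite) store"
  assumes X: "finite X" and "set_fml \<phi> \<subseteq> X" "similar X n w s h" "rank (card X) \<phi> \<le> n"
  shows "w \<phi> \<longleftrightarrow> (s, h) \<Turnstile> \<phi>"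
  using assms(2-)
proof (induction \<phi> arbitrary: n w h)
  case (Eq x y)
  then show ?case
    using agrees_eq[of X w s h x y] by (simp add: similar_def)
next
  case (PointsTo x y)
  then show ?case
    using agrees_pto[of X w s h x y] by (simp add: similar_def)
next
  case Emp
  then have "world w" "finite (dom h)" "w (size_ge 1) \<longleftrightarrow> 1 \<le> card (dom h)"
    unfolding similar_def agrees_def capped_def by auto
  then show ?case
    by (auto simp: Suc_le_eq card_gt_0_iff)
next
  case (Neg \<phi>)
  moreover have "world w"
    using Neg.prems(2) by (simp add: similar_def agrees_def)
  ultimately show ?case
    using Neg.IH[OF _ Neg.prems(2)] by simp
next
  case (And \<phi> \<psi>)
  moreover have "world w"
    using And.prems(2) by (simp add: similar_def agrees_def)
  ultimately show ?case
    using And.IH(1)[OF _ And.prems(2)] And.IH(2)[OF _ And.prems(2)] by simp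
next
  case (Star \<phi> \<psi>)
  let ?n1 = "rank (card X) \<phi>" and ?n2 = "rank (card X) \<psi>"
  have sim: "similar X (?n1 + ?n2 + card X) w s h"
    using Star.prems(2,3) by (auto intro: similar_mono)
  have sub: "set_fml \<phi> \<subseteq> X" "set_fml \<psi> \<subseteq> X"
    using Star.prems(1) by auto
  have w: "world w"
    using sim by (simp add: similar_def agrees_def)
  show ?case
  proof
    assume "w (\<phi> \<^bold>* \<psi>)"
    then obtain w1 w2 where c: "composes w1 w2 w" "w1 \<phi>" "w2 \<psi>"
      unfolding world_star_iff[OF w] by blast
    from split_heap[OF c(1) sim X] obtain h1 h2
      where h: "h1 \<sharp> h2" "h1 ++ h2 = h" "similar X ?n1 w1 s h1" "similar X ?n2 w2 s h2"
      by blast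
    then have "(s, h1) \<Turnstile> \<phi>" "(s, h2) \<Turnstile> \<psi>"
      using Star.IH(1)[OF sub(1) h(3)] Star.IH(2)[OF sub(2) h(4)] c by simp_all
    then show "(s, h) \<Turnstile> \<phi> \<^bold>* \<psi>"
      using h by auto
  next
    assume "(s, h) \<Turnstile> \<phi> \<^bold>* \<psi>"
    then obtain h1 h2 where h: "h1 \<sharp> h2" "h1 ++ h2 = h" "(s, h1) \<Turnstile> \<phi>" "(s, h2) \<Turnstile> \<psi>"
      by auto
    from split_world[OF _ h(1) X] sim h(2) obtain w1 w2
      where c: "composes w1 w2 w" "similar X ?n1 w1 s h1" "similar X ?n2 w2 s h2"
      by blast
    have "w1 \<phi>" "w2 \<psi>"
      using Star.IH(1)[OF sub(1) c(2)] Star.IH(2)[OF sub(2) c(3)] h by simp_all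
    then show "w (\<phi> \<^bold>* \<psi>)"
      by (rule compD[OF c(1)])
  qed
next
  case (Wand \<phi> \<psi>)
  have sub: "set_fml \<phi> \<subseteq> X" "set_fml \<psi> \<subseteq> X" "rank (card X) \<phi> \<le> n" "rank (card X) \<psi> \<le> n"
    using Wand.prems(1,3) by auto
  have w: "world w" and a: "agrees X w s h" and cap: "capped n w (card (dom h))" and fin: "finite (dom h)"
    using Wand.prems(2) by (auto simp: similar_def agrees_def)
  show ?case
  proof
    assume wand: "w (\<phi> \<^bold>-* \<psi>)"
    have "(s, h ++ h1) \<Turnstile> \<psi>" if h1: "finite (dom h1)" "h1 \<sharp> h" "(s, h1) \<Turnstile> \<phi>" for h1
    proof -
      from extend_heap[OF h1(1) X a h1(2)] obtain w1 w2
        where c: "composes w w1 w2" "w1 (size_eq (card (dom h1)))" "agrees X w1 s h1"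
        by blast
      have d: "h \<sharp> h1"
        using h1(2) disj_heaps_commute by blast
      have "similar X n w1 s h1" "similar X n w2 s (h ++ h1)"
        using c capped_size_eq[OF comp_world(2)[OF c(1)] c(2)] capped_comp[OF c(1) cap] agrees_comp[OF c(1) a c(3) d]
          card_dom_map_add[OF fin h1(1) d] unfolding similar_def by auto
      from Wand.IH(1)[OF sub(1) this(1) sub(3)] Wand.IH(2)[OF sub(2) this(2) sub(4)] show ?thesis
        using h1(3) wand c(1) unfolding world_wand_iff[OF w] by blast
    qed
    then show "(s, h) \<Turnstile> \<phi> \<^bold>-* \<psi>"
      by simp
  next
    assume wand: "(s, h) \<Turnstile> \<phi> \<^bold>-* \<psi>"
    have "w2 \<psi>" if c: "composes w w1 w2" "w1 \<phi>" for w1 w2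
    proof -
      from extend_world[OF c(1) Wand.prems(2) X] obtain h1
        where h1: "finite (dom h1)" "h1 \<sharp> h" "similar X n w1 s h1" "similar X n w2 s (h ++ h1)"
        by blast
      then show ?thesis
        using Wand.IH(1)[OF sub(1) h1(3) sub(3)] Wand.IH(2)[OF sub(2) h1(4) sub(4)] c(2) wand by simp
    qed
    then show "w (\<phi> \<^bold>-* \<psi>)"
      unfolding world_wand_iff[OF w] by blast
  qed
qed

section \<open>A countermodel for an underivable formula\<close>

lemma world_store:
  assumes "world w"
  shows "\<exists>s :: ('v::countable, 'l::infinite) store. \<forall>x y. w (x \<^bold>= y) \<longleftrightarrow> s x = s y"
proof -
  obtain f :: "nat \<Rightarrow> 'l" where f: "inj f"
    using infinite_countable_subset[OF infinite_UNIV] by blast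
  \<comment> \<open>Variables equal in \<open>w\<close> satisfy the same equations, so
    \<open>SOME\<close> picks the same representative for them; representatives are then mapped
    injectively to locations.\<close>
  define rep where "rep x = (SOME z. w (x \<^bold>= z))" for x
  have rep: "w (x \<^bold>= rep x)" for x
    unfolding rep_def by (rule someI[of _ x]) (rule world_eq_refl[OF assms])
  have "w (x \<^bold>= y) \<longleftrightarrow> rep x = rep y" for x y
  proof
    assume "w (x \<^bold>= y)"
    then have "(\<lambda>z. w (x \<^bold>= z)) = (\<lambda>z. w (y \<^bold>= z))"
      using world_eq_subst(1)[OF assms] by blast
    then show "rep x = rep y"
      by (simp add: rep_def)
  next
    assume "rep x = rep y"
    then show "w (x \<^bold>= y)"
      using rep[of x] rep[of y] world_eq_subst(2)[OF assms rep[of y], of x] by simp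
  qed
  then show ?thesis
    using f by (intro exI[of _ "\<lambda>x. f (to_nat (rep x))"]) (simp add: inj_eq)
qed

lemma completeness:
  fixes \<phi> :: "'v::countable fml"
  assumes "valid TYPE('l::infinite) \<phi>"
  shows "\<turnstile> \<phi>"
proof (rule ccontr)
  assume "\<not> \<turnstile> \<phi>"
  then obtain w where w: "world w" "\<not> w \<phi>"
    unfolding derivable_iff by blast
  obtain s :: "('v, 'l) store" where s: "\<forall>x y. w (x \<^bold>= y) \<longleftrightarrow> s x = s y"
    using world_store[OF w(1)] by blast
  define X where "X = set_fml \<phi>"
  have X: "finite X"
    by (simp add: X_def fml.set_finite)
  from s obtain e where e: "composes e w w" "e (size_eq 0)" "agrees X e s Map.empty"
    using unit_agrees[OF w(1), of X s] by blast
  have "similar X (rank (card X) \<phi>) e s Map.empty"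
    using e(3) capped_size_eq[OF comp_world(1)[OF e(1)] e(2)] by (simp add: similar_def)
  \<comment> \<open>\<open>w\<close> is regarded as an extension of the empty world \<open>e\<close>
    by \<open>w\<close> itself, so that its heap is built from the empty heap.\<close>
  from extend_world[OF e(1) this X] obtain h
    where h: "finite (dom h)" "similar X (rank (card X) \<phi>) w s h"
    by blast
  have "(s, h) \<Turnstile> \<phi>"
    using assms h(1) unfolding valid_def by blast
  then show False
    using truth_lemma[OF X _ h(2) order_refl] w(2) by (simp add: X_def)
qed

section \<open>Soundness\<close>

lemma sat_connectives [simp]:
  "\<not> (s, h) \<Turnstile> \<^bold>\<bottom>" "(s, h) \<Turnstile> \<^bold>\<top>"
  "(s, h) \<Turnstile> \<phi> \<^bold>\<or> \<psi> \<longleftrightarrow> (s, h) \<Turnstile> \<phi> \<or> (s, h) \<Turnstile> \<psi>"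
  "(s, h) \<Turnstile> \<phi> \<^bold>\<longrightarrow> \<psi> \<longleftrightarrow> ((s, h) \<Turnstile> \<phi> \<longrightarrow> (s, h) \<Turnstile> \<psi>)"
  "(s, h) \<Turnstile> \<phi> \<^bold>\<longleftrightarrow> \<psi> \<longleftrightarrow> ((s, h) \<Turnstile> \<phi> \<longleftrightarrow> (s, h) \<Turnstile> \<psi>)"
  "(s, h) \<Turnstile> x \<^bold>\<noteq> y \<longleftrightarrow> s x \<noteq> s y"
  "(s, h) \<Turnstile> \<phi> \<^bold>-\<circledast> \<psi> \<longleftrightarrow>
     (\<exists>h1. finite (dom h1) \<and> h1 \<sharp> h \<and> (s, h1) \<Turnstile> \<phi> \<and> (s, h ++ h1) \<Turnstile> \<psi>)"
  by (auto simp: Bot_def Top_def Or_def Imp_def Iff_def Neq_def Septraction_def)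

lemma sat_big_and [simp]: "(s, h) \<Turnstile> \<^bold>\<And> \<phi>s \<longleftrightarrow> (\<forall>\<phi>\<in>set \<phi>s. (s, h) \<Turnstile> \<phi>)"
  unfolding big_and_def by (induction \<phi>s) auto

lemma sat_pinst: "(s, h) \<Turnstile> pinst \<sigma> p \<longleftrightarrow> peval (\<lambda>n. (s, h) \<Turnstile> \<sigma> n) p"
  by (induction p) auto

text \<open>Renaming in a formula is precomposition of the store; when the exchanged variables have
  the same value the store is unchanged, which gives A2.\<close>

lemma sat_map: "(s, h) \<Turnstile> map_fml f \<phi> \<longleftrightarrow> (s \<circ> f, h) \<Turnstile> \<phi>"
  by (induction \<phi> arbitrary: h) auto

lemma sat_replace:
  assumes "s x = s y"
  shows "(s, h) \<Turnstile> replace y x \<phi> \<longleftrightarrow> (s, h) \<Turnstile> \<phi>"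
proof -
  have "s \<circ> (\<lambda>z. if z = y then x else z) = s"
    using assms by auto
  then show ?thesis
    by (simp add: replace_def sat_map)
qed

lemma sat_alloc [simp]: "(s, h) \<Turnstile> alloc x \<longleftrightarrow> s x \<in> dom h"
proof
  assume "(s, h) \<Turnstile> alloc x"
  \<comment> \<open>If \<open>s x\<close> were not allocated, this one-cell heap could be added and
    the wand would yield falsum.\<close>
  then have "\<not> [s x \<mapsto> s x] \<sharp> h"
    unfolding alloc_def by (auto dest: spec[of _ "[s x \<mapsto> s x]"])
  then show "s x \<in> dom h"
    by (auto simp: disj_heaps_iff)
qed (auto simp: alloc_def disj_heaps_iff)

lemma sat_starI:
  "h1 \<sharp> h2 \<Longrightarrow> (s, h1) \<Turnstile> \<phi> \<Longrightarrow> (s, h2) \<Turnstile> \<psi> \<Longrightarrow> (s, h1 ++ h2) \<Turnstile> \<phi> \<^bold>* \<psi>"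
  by auto

lemma sat_starE:
  assumes "(s, h) \<Turnstile> \<phi> \<^bold>* \<psi>" "finite (dom h)"
  obtains h1 h2 where "h1 \<sharp> h2" "h = h1 ++ h2" "finite (dom h1)" "finite (dom h2)"
    "(s, h1) \<Turnstile> \<phi>" "(s, h2) \<Turnstile> \<psi>"
proof -
  obtain h1 h2 where "h1 \<sharp> h2" "h1 ++ h2 = h" "(s, h1) \<Turnstile> \<phi>" "(s, h2) \<Turnstile> \<psi>"
    using assms(1) unfolding sat.simps by blast
  then show thesis
    using that[of h1 h2] assms(2) by auto
qed

lemma sat_size_ge [simp]: "finite (dom h) \<Longrightarrow> (s, h) \<Turnstile> size_ge n \<longleftrightarrow> n \<le> card (dom h)"
proof (induction n arbitrary: h rule: size_ge.induct)
  case 1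
  then show ?case
    by simp
next
  case 2
  then show ?case
    by (auto simp: Suc_le_eq card_gt_0_iff)
next
  case (3 n)
  show ?case
  proof
    assume "(s, h) \<Turnstile> size_ge (Suc (Suc n))"
    then obtain h1 h2 where h: "h1 \<sharp> h2" "h1 ++ h2 = h" "dom h1 \<noteq> {}" "(s, h2) \<Turnstile> size_ge (Suc n)"
      by auto
    then have fin: "finite (dom h1)" "finite (dom h2)"
      using 3(2) by auto
    then have "Suc 0 \<le> card (dom h1)" "Suc n \<le> card (dom h2)"
      using 3(1)[OF fin(2)] h(3,4) by (auto simp: Suc_le_eq card_gt_0_iff)
    then show "Suc (Suc n) \<le> card (dom h)"
      using card_dom_map_add[OF fin h(1)] h(2) by simp
  next
    assume n: "Suc (Suc n) \<le> card (dom h)"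
    then obtain l where l: "l \<in> dom h"
      using 3(2) by (metis card.empty equals0I not_less_eq_eq zero_le)
    have fin: "finite (dom (h |` {l}))" "finite (dom (h |` (- {l})))"
      using 3(2) by auto
    have dom: "dom (h |` {l}) = {l}"
      using l by auto
    have "card (dom h) = card (dom (h |` {l})) + card (dom (h |` (- {l})))"
      using card_dom_map_add[OF fin restrict_split(1)] by (simp add: restrict_split(2))
    then have "Suc n \<le> card (dom (h |` (- {l})))"
      using n dom by simp
    then have "(s, h |` (- {l})) \<Turnstile> size_ge (Suc n)"
      using 3(1)[OF fin(2)] by blast
    moreover have "(s, h |` {l}) \<Turnstile> \<^bold>\<not> Emp"
      using dom by simp
    ultimately have "(s, h |` {l} ++ h |` (- {l})) \<Turnstile> \<^bold>\<not> Emp \<^bold>* size_ge (Suc n)"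
      by (intro sat_starI restrict_split(1))
    then show "(s, h) \<Turnstile> size_ge (Suc (Suc n))"
      by (simp only: restrict_split(2) size_ge.simps)
  qed
qed

lemma sat_size_eq [simp]: "finite (dom h) \<Longrightarrow> (s, h) \<Turnstile> size_eq n \<longleftrightarrow> card (dom h) = n"
  by (auto simp: size_eq_def)

lemma sat_star_commute: "(s, h) \<Turnstile> \<phi> \<^bold>* \<psi> \<longleftrightarrow> (s, h) \<Turnstile> \<psi> \<^bold>* \<phi>"
proof -
  have "(s, h) \<Turnstile> \<psi> \<^bold>* \<phi>" if star: "(s, h) \<Turnstile> \<phi> \<^bold>* \<psi>" for \<phi> \<psi>
  proof -
    obtain h1 h2 where h: "h1 \<sharp> h2" "h1 ++ h2 = h" "(s, h1) \<Turnstile> \<phi>" "(s, h2) \<Turnstile> \<psi>"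
      using star unfolding sat.simps by blast
    then have "h2 \<sharp> h1" "h2 ++ h1 = h"
      using map_add_comm[of h1 h2] by (auto simp: disj_heaps_def)
    then show ?thesis
      using sat_starI h by blast
  qed
  then show ?thesis
    by blast
qed

lemma sat_star_assoc: "(s, h) \<Turnstile> (\<phi> \<^bold>* \<psi>) \<^bold>* \<chi> \<longleftrightarrow> (s, h) \<Turnstile> \<phi> \<^bold>* (\<psi> \<^bold>* \<chi>)"
proof
  assume "(s, h) \<Turnstile> (\<phi> \<^bold>* \<psi>) \<^bold>* \<chi>"
  then obtain h1 h2 h3 where h: "h1 \<sharp> h2" "(h1 ++ h2) \<sharp> h3" "(h1 ++ h2) ++ h3 = h"
      "(s, h1) \<Turnstile> \<phi>" "(s, h2) \<Turnstile> \<psi>" "(s, h3) \<Turnstile> \<chi>"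
    by auto
  moreover have "h2 \<sharp> h3" "h1 \<sharp> (h2 ++ h3)"
    using h(1,2) by (auto simp: disj_heaps_def)
  ultimately show "(s, h) \<Turnstile> \<phi> \<^bold>* (\<psi> \<^bold>* \<chi>)"
    unfolding sat.simps by (metis map_add_assoc)
next
  assume "(s, h) \<Turnstile> \<phi> \<^bold>* (\<psi> \<^bold>* \<chi>)"
  then obtain h1 h2 h3 where h: "h2 \<sharp> h3" "h1 \<sharp> (h2 ++ h3)" "h1 ++ (h2 ++ h3) = h"
      "(s, h1) \<Turnstile> \<phi>" "(s, h2) \<Turnstile> \<psi>" "(s, h3) \<Turnstile> \<chi>"
    by auto
  moreover have "h1 \<sharp> h2" "(h1 ++ h2) \<sharp> h3"
    using h(1,2) by (auto simp: disj_heaps_def)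
  ultimately show "(s, h) \<Turnstile> (\<phi> \<^bold>* \<psi>) \<^bold>* \<chi>"
    unfolding sat.simps by (metis map_add_assoc)
qed

lemma sat_cell:
  assumes "l \<in> dom h"
  shows "\<exists>h1 h2. h1 \<sharp> h2 \<and> h = h1 ++ h2 \<and> dom h1 = {l}"
proof -
  have "dom (h |` {l}) = {l}"
    using assms by auto
  then show ?thesis
    using restrict_split[of h "{l}"] by metis
qed

text \<open>The heap varies in the induction because the rules change it: \<open>Star_Adj\<close>
  uses its premise at \<open>h ++ h1\<close> and \<open>Wand_Adj\<close> at a part
  \<open>h1\<close>, both finite.\<close>

lemma soundness:
  fixes s :: "('v, 'l::infinite) store"
  assumes "\<turnstile> \<phi>" "finite (dom h)"
  shows "(s, h) \<Turnstile> \<phi>"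
  using assms
proof (induction arbitrary: h rule: derivable.induct)
  case (Taut p \<sigma>)
  then show ?case
    by (simp add: sat_pinst tautology_def)
next
  case (A2 \<phi> x y)
  then show ?case
    by (simp add: sat_replace)
next
  case (A7 \<phi> \<psi>)
  show ?case
    unfolding sat_connectives by (rule sat_star_commute)
next
  case (A8 \<phi> \<psi> \<chi>)
  show ?case
    unfolding sat_connectives by (rule sat_star_assoc)
next
  case (I9 \<phi> \<psi> \<chi>)
  show ?case
    by auto
next
  case (A11 \<phi>)
  have "(s, h) \<Turnstile> \<phi> \<^bold>* Emp" if "(s, h) \<Turnstile> \<phi>"
    using that unfolding sat.simps by (intro exI[of _ h] exI[of _ Map.empty]) (simp add: disj_heaps_def)
  then show ?case
    by auto
next
  case (I12 x)
  then show ?case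
    by (auto simp: map_add_eq_Some)
next
  case (I13 x)
  then show ?case
    by (auto simp: disj_heaps_iff)
next
  case (A14_pto x y)
  then show ?case
    by (auto simp: map_add_eq_Some)
next
  case (A16 x y)
  have False if "h1 \<sharp> h2" "h1 (s x) = Some l" "l \<noteq> s y" "(h1 ++ h2) (s x) = Some (s y)" for h1 h2 l
    using that by (auto simp: disj_heaps_iff map_add_eq_Some)
  then show ?case
    by fastforce
next
  case (A17 x)
  have "(s, h) \<Turnstile> (alloc x \<^bold>\<and> size_eq 1) \<^bold>* \<^bold>\<top>" if x: "s x \<in> dom h"
  proof -
    obtain h1 h2 where h: "h1 \<sharp> h2" "h = h1 ++ h2" "dom h1 = {s x}"
      using sat_cell[OF x] by blast
    show ?thesis
      unfolding h(2) by (rule sat_starI[OF h(1)]) (simp_all add: h(3))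
  qed
  then show ?case
    by simp
next
  case A18
  have "(s, h) \<Turnstile> size_eq 1 \<^bold>* \<^bold>\<top>" if l: "l \<in> dom h" for l
  proof -
    obtain h1 h2 where h: "h1 \<sharp> h2" "h = h1 ++ h2" "dom h1 = {l}"
      using sat_cell[OF l] by blast
    show ?thesis
      unfolding h(2) by (rule sat_starI[OF h(1)]) (simp_all add: h(3))
  qed
  then show ?case
    unfolding sat_connectives sat.simps(3,4) by blast
next
  case (A19 m n)
  then show ?case
    by (auto simp: card_dom_map_add elim!: sat_starE simp del: sat.simps(6) dom_map_add)
next
  case (A20 x y)
  have "2 \<le> card (dom h)" if "s x \<in> dom h" "s y \<in> dom h" "s x \<noteq> s y"
    using that card_mono[OF A20, of "{s x, s y}"] by simp
  then show ?case
    using A20 by simp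
next
  case (A21 X)
  \<comment> \<open>A location outside the heap and the values of \<open>X\<close> exists because
    there are infinitely many locations.\<close>
  obtain l where "l \<notin> dom h \<union> s ` set X"
    using ex_new_if_finite[OF infinite_UNIV, of "dom h \<union> s ` set X"] A21 by auto
  then show ?case
    unfolding sat_connectives by (intro exI[of _ "[l \<mapsto> l]"]) (auto simp: disj_heaps_iff)
next
  case (A22 x y)
  have "(s, h) \<Turnstile> (x \<^bold>\<hookrightarrow> y \<^bold>\<and> size_eq 1) \<^bold>-\<circledast> \<^bold>\<top>" if "s x \<notin> dom h"
    using that unfolding sat_connectives by (intro exI[of _ "[s x \<mapsto> s y]"]) (auto simp: disj_heaps_iff)
  then show ?case
    by simp
next
  case (A23 X x)
  \<comment> \<open>Here \<open>l\<close> is only the target of the new cell, which sits at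
    \<open>s x\<close>; hence it has to avoid the values of \<open>X\<close> but not the
    heap.\<close>
  obtain l where "l \<notin> s ` set X"
    using ex_new_if_finite[OF infinite_UNIV, of "s ` set X"] by auto
  then have "(s, h) \<Turnstile> (alloc x \<^bold>\<and> size_eq 1 \<^bold>\<and> \<^bold>\<And> (map (\<lambda>y. \<^bold>\<not> (x \<^bold>\<hookrightarrow> y)) X)) \<^bold>-\<circledast> \<^bold>\<top>"
    if "s x \<notin> dom h"
    using that unfolding sat_connectives by (intro exI[of _ "[s x \<mapsto> l]"]) (auto simp: disj_heaps_iff)
  then show ?case
    by simp
next
  case (Star_Intro \<phi> \<chi> \<psi>)
  have "(s, h1) \<Turnstile> \<chi>" if "(s, h1) \<Turnstile> \<phi>" "h1 ++ h2 = h" for h1 h2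
    using Star_Intro.IH[of h1] Star_Intro.prems that by auto
  then show ?case
    by fastforce
next
  case (Star_Adj \<phi> \<psi> \<chi>)
  have "(s, h ++ h1) \<Turnstile> \<chi>" if "(s, h) \<Turnstile> \<phi>" "finite (dom h1)" "h1 \<sharp> h" "(s, h1) \<Turnstile> \<psi>" for h1
  proof -
    have "(s, h ++ h1) \<Turnstile> \<phi> \<^bold>* \<psi>"
      using that disj_heaps_commute by auto
    then show ?thesis
      using Star_Adj.IH[of "h ++ h1"] Star_Adj.prems that(2) by simp
  qed
  then show ?case
    by simp
next
  case (Wand_Adj \<phi> \<psi> \<chi>)
  have "(s, h) \<Turnstile> \<chi>" if "(s, h) \<Turnstile> \<phi> \<^bold>* \<psi>"
    using that Wand_Adj.prems
  proof (rule sat_starE)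
    fix h1 h2
    assume h: "h1 \<sharp> h2" "h = h1 ++ h2" "finite (dom h1)" "finite (dom h2)" "(s, h1) \<Turnstile> \<phi>" "(s, h2) \<Turnstile> \<psi>"
    then have "h2 \<sharp> h1"
      using disj_heaps_commute by blast
    then show ?thesis
      using Wand_Adj.IH[OF h(3)] h by simp
  qed
  then show ?case
    unfolding sat_connectives by blast
qed auto

theorem theorem3p6:
  fixes \<phi> :: "'v::{countable,infinite} fml"
  shows "valid TYPE('l::{countable,infinite}) \<phi> \<longleftrightarrow> \<turnstile> \<phi>"
proof
  show "\<turnstile> \<phi>" if "valid TYPE('l) \<phi>"
    using that by (rule completeness)
  show "valid TYPE('l) \<phi>" if "\<turnstile> \<phi>"
    unfolding valid_def using soundness[OF that] by blast
qed

end
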